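(* Assume that $\rho_0'$ is a nonnegative continuous compactly supported function on $\mathbb{R}$ with $\operatorname{supp}(\rho_0')=[-a,a]$, and that $\rho_0(x)=\rho_-$ for $x\le -a$ and $\rho_0(x)=\rho_+$ for $x\ge a$, where $0<\rho_-<\rho_+$ are constants. Then there exists an infinite sequence $(\lambda_n,\phi_n)_{n\ge 1}$ with $\lambda_n\in\left(0,\sqrt{g/L_0}\right)$ and $\phi_n\in H^4(\mathbb{R})$, $\phi_n\not\equiv 0$, such that for each $n$, on $\mathbb{R}$, $$-\lambda_n^2\left(\rho_0k^2\phi_n-(\rho_0\phi_n')'\right)=\lambda_n\mu\left(\phi_n^{(4)}-2k^2\phi_n''+k^4\phi_n\right)-gk^2\rho_0'\phi_n .$$ In addition, $\lambda_n$ decreases towards $0$ as $n\to\infty$.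
   Context: The constants $g>0$, $\mu>0$, $k>0$, $a>0$ are fixed. The function $\rho_0:\mathbb{R}\to(0,\infty)$ is of class $C^1$, primes denote $d/dx$, and $L_0>0$ is defined by $L_0^{-1}=\sup_{\mathbb{R}}\rho_0'/\rho_0$. All functions are real-valued. *)

theory Defs
  imports "HOL-Analysis.Analysis"
begin

definition test_function :: "(real \<Rightarrow> real) \<Rightarrow> bool" where
  "test_function \<psi> \<longleftrightarrow>
     (\<forall>m x. ((deriv ^^ m) \<psi>) differentiable (at x)) \<and> compact (closure {x. \<psi> x \<noteq> 0})"

definition locally_integrable :: "(real \<Rightarrow> real) \<Rightarrow> bool" where
  "locally_integrable u \<longleftrightarrow> (\<forall>c d. set_integrable lebesgue {c..d} u)"

text \<open>\<open>weak_deriv m u v\<close>: \<open>v\<close> is (a representative of) the \<open>m\<close>-th distributional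
  derivative of \<open>u\<close>. It is a relation rather than a function, since \<open>v\<close> is only
  determined up to a null set.\<close>

definition weak_deriv :: "nat \<Rightarrow> (real \<Rightarrow> real) \<Rightarrow> (real \<Rightarrow> real) \<Rightarrow> bool" where
  "weak_deriv m u v \<longleftrightarrow>
     locally_integrable u \<and> locally_integrable v \<and>
     (\<forall>\<psi>. test_function \<psi> \<longrightarrow>
        (LINT x|lebesgue. v x * \<psi> x) = (-1) ^ m * (LINT x|lebesgue. u x * (deriv ^^ m) \<psi> x))"

definition L2 :: "(real \<Rightarrow> real) set" where
  "L2 = {u. u \<in> borel_measurable lebesgue \<and> integrable lebesgue (\<lambda>x. (u x)\<^sup>2)}"

text \<open>The Sobolev space \<open>H\<^sup>m\<close> on the real line. Its elements are represented by functions, not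
  by classes modulo equality almost everywhere.\<close>

definition sobolev_H :: "nat \<Rightarrow> (real \<Rightarrow> real) set" where
  "sobolev_H m = {u \<in> L2. \<forall>j\<le>m. \<exists>v\<in>L2. weak_deriv j u v}"

end

theory Submission
  imports Defs "HOL-Complex_Analysis.Great_Picard"
begin

text \<open>It suffices to find modes with arbitrarily small growth rate. The weak form of the equation
  with parameter \<open>l\<close> is a symmetric form \<open>Q l\<close>; the two half lines outside \<open>[-a, a]\<close>, where the
  decaying solutions are explicit exponentials, only contribute boundary terms. The form
  \<open>Q 0 = - g k\<^sup>2 \<integral>\<rho>' v w\<close> is negative definite on spaces of any dimension, whereas \<open>Q \<epsilon>\<close> has
  finite index for \<open>\<epsilon> > 0\<close>. At the parameter \<open>l \<in> (0, \<epsilon>]\<close> where the index drops below a given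
  number, a limit of negative directions minimizes \<open>Q l\<close>, with minimum \<open>0\<close>, over the complement of
  a maximal negative subspace. By the parallelogram identity the minimizing sequence converges in
  \<open>H\<^sup>2\<close>, and its limit lies in the kernel of \<open>Q l\<close>, that is, it is a mode.\<close>

section \<open>Negative subspaces of symmetric forms\<close>

text \<open>The parameter enters through \<open>l\<close>, \<open>l^2\<close> and, once the half
  lines are eliminated, through \<open>\<tau>\<close>, so modes are not eigenvectors of one fixed
  operator. Following the index of \<open>Q l\<close> replaces spectral theory: it needs only
  continuity in \<open>l\<close> for fixed vectors. Working on the compact interval makes uniformly
  convergent subsequences available. The negative directions are only known to lie in the complement
  \<open>W\<close>, while the equation must be tested against everything. The inequality
  \<open>(Q l w x)^2 \<le> Q l w w * C x\<close> bridges this: \<open>w\<close> is in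
  \<open>W\<close>, but \<open>x\<close> is arbitrary. \<open>C2\<close> is not complete in the
  Sobolev norm, so the limit is not an element of it. Only \<open>d0\<close> and \<open>d1\<close>
  converge uniformly; the missing regularity comes from a first-order system solved by integration,
  after the residual \<open>\<mu> * d2 (v j) + G\<close> is shown to vanish in L2. The directions
  are normalized by their buoyancy because it is continuous under uniform convergence of
  \<open>d0\<close>; this keeps the limit from being zero.\<close>

lemma homogeneous_system_nontrivial:
  fixes M :: "'k \<Rightarrow> 'i \<Rightarrow> real"
  assumes "finite K" "finite I" "card K < card I"
  shows "\<exists>c. (\<exists>i\<in>I. c i \<noteq> 0) \<and> (\<forall>k\<in>K. (\<Sum>i\<in>I. M k i * c i) = 0)"
  using assms
proof (induction K arbitrary: I M rule: finite_induct)
  case empty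
  then have "I \<noteq> {}" by auto
  then show ?case by (intro exI[of _ "\<lambda>_. 1"]) auto
next
  case (insert k K)
  show ?case
  proof (cases "\<forall>i\<in>I. M k i = 0")
    case True
    have "card K < card I" using insert by auto
    then obtain c where "\<exists>i\<in>I. c i \<noteq> 0" "\<forall>k\<in>K. (\<Sum>i\<in>I. M k i * c i) = 0"
      using insert.IH[of I M] insert.prems by auto
    then show ?thesis using True by (intro exI[of _ c]) auto
  next
    case False
    then obtain p where p: "p \<in> I" "M k p \<noteq> 0" by auto
    define J where "J = I - {p}"
    \<comment> \<open>Gaussian elimination: \<open>M'\<close> is row \<open>l\<close> after the
      unknown \<open>p\<close> has been solved for from row \<open>k\<close>; \<open>d\<close> below
      restores \<open>p\<close> by back substitution.\<close>
    define M' where "M' = (\<lambda>l i. M l i - M l p * M k i / M k p)"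
    have "card K < card J" using insert p by (auto simp: J_def)
    moreover have fJ: "finite J" using insert by (auto simp: J_def)
    ultimately obtain c where c: "\<exists>i\<in>J. c i \<noteq> 0" "\<forall>l\<in>K. (\<Sum>i\<in>J. M' l i * c i) = 0"
      using insert.IH[of J M'] by auto
    define d where "d = c(p := - (\<Sum>i\<in>J. M k i * c i) / M k p)"
    have sumI: "(\<Sum>i\<in>I. M l i * d i) = M l p * d p + (\<Sum>i\<in>J. M l i * c i)" for l
    proof -
      have "(\<Sum>i\<in>I. M l i * d i) = M l p * d p + (\<Sum>i\<in>J. M l i * d i)"
        unfolding J_def using p insert.prems by (simp add: sum.remove)
      also have "(\<Sum>i\<in>J. M l i * d i) = (\<Sum>i\<in>J. M l i * c i)"
        by (rule sum.cong) (auto simp: d_def J_def)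
      finally show ?thesis .
    qed
    have "(\<Sum>i\<in>I. M k i * d i) = 0"
      unfolding sumI using p by (simp add: d_def)
    moreover have "(\<Sum>i\<in>I. M l i * d i) = 0" if "l \<in> K" for l
    proof -
      have "0 = (\<Sum>i\<in>J. M' l i * c i)" using c that by simp
      also have "\<dots> = (\<Sum>i\<in>J. M l i * c i - M l p / M k p * (M k i * c i))"
        by (rule sum.cong) (auto simp: M'_def algebra_simps)
      also have "\<dots> = (\<Sum>i\<in>J. M l i * c i) - M l p / M k p * (\<Sum>i\<in>J. M k i * c i)"
        by (simp add: sum_subtractf sum_distrib_left)
      also have "\<dots> = (\<Sum>i\<in>I. M l i * d i)"
        unfolding sumI by (simp add: d_def)
      finally show ?thesis by simp
    qed
    moreover have "\<exists>i\<in>I. d i \<noteq> 0"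
      using c(1) by (auto simp: d_def J_def)
    ultimately show ?thesis by (intro exI[of _ d]) auto
  qed
qed

section \<open>The negative index and orthonormal families\<close>

definition symmetric_form :: "('v::real_vector \<Rightarrow> 'v \<Rightarrow> real) \<Rightarrow> bool" where
  "symmetric_form Q \<longleftrightarrow> (\<forall>x. linear (Q x)) \<and> (\<forall>x y. Q x y = Q y x)"

text \<open>Linear independence of \<open>u\<close> is built in, since a vanishing nontrivial
  combination would have the value 0. The predicate thus expresses that the negative index is at
  least \<open>n\<close>.\<close>

definition negative_definite :: "('v::real_vector \<Rightarrow> 'v \<Rightarrow> real) \<Rightarrow> nat \<Rightarrow> bool" where
  "negative_definite Q n \<longleftrightarrow> (\<exists>u. \<forall>c. (\<exists>i<n. c i \<noteq> 0) \<longrightarrow>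
     Q (\<Sum>i<n. c i *\<^sub>R u i) (\<Sum>i<n. c i *\<^sub>R u i) < 0)"

definition negative_orthonormal :: "('v::real_vector \<Rightarrow> 'v \<Rightarrow> real) \<Rightarrow> nat \<Rightarrow> (nat \<Rightarrow> 'v) \<Rightarrow> bool" where
  "negative_orthonormal Q n e \<longleftrightarrow> (\<forall>i<n. \<forall>j<n. Q (e i) (e j) = (if i = j then -1 else 0))"

lemma symmetric_formD:
  assumes "symmetric_form Q"
  shows "Q x y = Q y x"
    "Q (x + x') y = Q x y + Q x' y" "Q x (y + y') = Q x y + Q x y'"
    "Q (x - x') y = Q x y - Q x' y" "Q x (y - y') = Q x y - Q x y'"
    "Q (c *\<^sub>R x) y = c * Q x y" "Q x (c *\<^sub>R y) = c * Q x y"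
    "Q (\<Sum>i\<in>I. f i) y = (\<Sum>i\<in>I. Q (f i) y)" "Q x (\<Sum>i\<in>I. f i) = (\<Sum>i\<in>I. Q x (f i))"
proof -
  have l: "linear (Q x)" for x using assms by (auto simp: symmetric_form_def)
  have s: "Q x y = Q y x" for x y using assms by (auto simp: symmetric_form_def)
  show "Q x y = Q y x" by (rule s)
  show "Q x (y + y') = Q x y + Q x y'" "Q x (y - y') = Q x y - Q x y'"
    "Q x (c *\<^sub>R y) = c * Q x y" "Q x (\<Sum>i\<in>I. f i) = (\<Sum>i\<in>I. Q x (f i))"
    using linear_add[OF l] linear_diff[OF l] linear_cmul[OF l] linear_sum[OF l] by auto
  show "Q (x + x') y = Q x y + Q x' y" "Q (x - x') y = Q x y - Q x' y"
    "Q (c *\<^sub>R x) y = c * Q x y" "Q (\<Sum>i\<in>I. f i) y = (\<Sum>i\<in>I. Q (f i) y)"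
    using linear_add[OF l] linear_diff[OF l] linear_cmul[OF l] linear_sum[OF l]
    by (simp_all add: s[of _ y])
qed

lemma symmetric_form_combination:
  assumes "symmetric_form Q"
  shows "Q (\<Sum>i<n. c i *\<^sub>R u i) (\<Sum>i<n. c i *\<^sub>R u i) = (\<Sum>i<n. \<Sum>j<n. c i * c j * Q (u i) (u j))"
  by (simp add: symmetric_formD[OF assms] sum_distrib_left sum_distrib_right mult.assoc mult.left_commute)

text \<open>The deviation of the Gram matrix contributes at most
  \<open>(\<Sum>|c i|)^2 / (n + 1)\<close>, hence by Cauchy-Schwarz at most
  \<open>n / (n + 1)\<close> times \<open>\<Sum>(c i)^2\<close>. This slack makes negative
  definiteness an open condition on a parameter.\<close>

lemma negative_definite_perturb:
  assumes "symmetric_form Q"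
    and close: "\<And>i j. i < n \<Longrightarrow> j < n \<Longrightarrow> \<bar>Q (e i) (e j) - (if i = j then -1 else 0)\<bar> < 1 / (real n + 1)"
  shows "negative_definite Q n"
  unfolding negative_definite_def
proof (intro exI[of _ e] allI impI)
  fix c :: "nat \<Rightarrow> real"
  assume nz: "\<exists>i<n. c i \<noteq> 0"
  define S where "S = (\<Sum>i<n. (c i)\<^sup>2)"
  have S: "S > 0"
  proof -
    from nz obtain i where "i < n" "c i \<noteq> 0" by auto
    then have "S \<ge> (c i)\<^sup>2" unfolding S_def by (intro member_le_sum) auto
    with \<open>c i \<noteq> 0\<close> show ?thesis by (smt (verit) zero_less_power2)
  qed
  have "Q (\<Sum>i<n. c i *\<^sub>R e i) (\<Sum>i<n. c i *\<^sub>R e i) + S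
      = (\<Sum>i<n. \<Sum>j<n. c i * c j * (Q (e i) (e j) - (if i = j then -1 else 0)))"
  proof -
    have "(\<Sum>i<n. \<Sum>j<n. c i * c j * (if i = j then -1 else 0)) = (\<Sum>i<n. - (c i)\<^sup>2)"
      by (rule sum.cong) (auto simp: if_distrib power2_eq_square cong: if_cong)
    then show ?thesis
      unfolding symmetric_form_combination[OF assms(1)] S_def
      by (simp add: right_diff_distrib sum_subtractf sum_negf)
  qed
  also have "\<dots> \<le> (\<Sum>i<n. \<Sum>j<n. \<bar>c i\<bar> * \<bar>c j\<bar> * (1 / (real n + 1)))"
  proof (intro sum_mono)
    fix i j assume "i \<in> {..<n}" "j \<in> {..<n}"
    then have *: "\<bar>Q (e i) (e j) - (if i = j then -1 else 0)\<bar> \<le> 1 / (real n + 1)" using close[of i j] by simp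
    have "c i * c j * (Q (e i) (e j) - (if i = j then -1 else 0))
       \<le> \<bar>c i * c j * (Q (e i) (e j) - (if i = j then -1 else 0))\<bar>" by simp
    also have "\<dots> = \<bar>c i\<bar> * \<bar>c j\<bar> * \<bar>Q (e i) (e j) - (if i = j then -1 else 0)\<bar>" by (simp add: abs_mult)
    also have "\<dots> \<le> \<bar>c i\<bar> * \<bar>c j\<bar> * (1 / (real n + 1))"
      by (intro mult_left_mono *) auto
    finally show "c i * c j * (Q (e i) (e j) - (if i = j then -1 else 0)) \<le> \<bar>c i\<bar> * \<bar>c j\<bar> * (1 / (real n + 1))" .
  qed
  also have "\<dots> = (\<Sum>i<n. \<bar>c i\<bar>)\<^sup>2 / (real n + 1)"
    by (simp add: power2_eq_square sum_product sum_divide_distrib)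
  also have "\<dots> \<le> (real n * S) / (real n + 1)"
  proof (rule divide_right_mono)
    have "(\<Sum>i<n. 1 * \<bar>c i\<bar>)\<^sup>2 \<le> (\<Sum>i<n. 1\<^sup>2) * (\<Sum>i<n. \<bar>c i\<bar>\<^sup>2)"
      by (rule Cauchy_Schwarz_ineq_sum)
    then show "(\<Sum>i<n. \<bar>c i\<bar>)\<^sup>2 \<le> real n * S" by (simp add: S_def)
  qed auto
  also have "\<dots> < S" using S by (simp add: field_simps)
  finally show "Q (\<Sum>i<n. c i *\<^sub>R e i) (\<Sum>i<n. c i *\<^sub>R e i) < 0" by simp
qed

lemma negative_orthonormal_imp_negative_definite:
  "symmetric_form Q \<Longrightarrow> negative_orthonormal Q n e \<Longrightarrow> negative_definite Q n"
  by (rule negative_definite_perturb[of Q n e]) (auto simp: negative_orthonormal_def)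

text \<open>Take a family of greatest length: a negative vector orthogonal to it could be normalized
  and appended.\<close>

lemma maximal_negative_orthonormal:
  assumes Q: "symmetric_form Q" and no: "\<nexists>e. negative_orthonormal Q n e"
  shows "\<exists>r e. r < n \<and> negative_orthonormal Q r e \<and>
    (\<forall>w. (\<forall>i<r. Q w (e i) = 0) \<longrightarrow> Q w w \<ge> 0)"
proof -
  let ?os = "\<lambda>r. \<exists>e. negative_orthonormal Q r e"
  have 0: "?os 0" by (simp add: negative_orthonormal_def)
  have lt: "r < n" if "?os r" for r
  proof (rule ccontr)
    assume "\<not> r < n"
    then have "?os n" using that unfolding negative_orthonormal_def by (meson le_less_trans not_less order_less_le_trans)
    with no show False by simp
  qed
  define r where "r = Greatest ?os"
  have r: "?os r" unfolding r_def by (rule GreatestI_nat[of ?os 0 n]) (use 0 lt less_imp_le in auto)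
  have mx: "\<not> ?os (Suc r)"
  proof
    assume "?os (Suc r)"
    then have "Suc r \<le> r" unfolding r_def by (intro Greatest_le_nat[of ?os _ n]) (use lt less_imp_le in auto)
    then show False by simp
  qed
  from r obtain e where e: "negative_orthonormal Q r e" by blast
  have "Q w w \<ge> 0" if orth: "\<And>i. i < r \<Longrightarrow> Q w (e i) = 0" for w
  proof (rule ccontr)
    assume neg: "\<not> Q w w \<ge> 0"
    define w' where "w' = (1 / sqrt (- Q w w)) *\<^sub>R w"
    have "Q w' w' = -1" using neg by (simp add: w'_def symmetric_formD[OF Q] real_sqrt_mult_self field_simps)
    moreover have "Q w' (e i) = 0" "Q (e i) w' = 0" if "i < r" for i
      using orth[OF that] symmetric_formD(1)[OF Q, of w "e i"]
      by (simp_all add: w'_def symmetric_formD(6,7)[OF Q])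
    ultimately have "negative_orthonormal Q (Suc r) (e(r := w'))"
      using e by (auto simp: negative_orthonormal_def less_Suc_eq)
    with mx show False by blast
  qed
  then show ?thesis using e lt[OF r] by (intro exI[of _ r] exI[of _ e]) auto
qed

lemma combination_orthogonal:
  fixes r n :: nat
  assumes Q: "symmetric_form Q" and "r < n"
  shows "\<exists>c. (\<exists>i<n. c i \<noteq> 0) \<and> (\<forall>k<r. Q (\<Sum>i<n. c i *\<^sub>R u i) (e k) = 0)"
proof -
  have "card {..<r} < card {..<n}" using assms(2) by simp
  from homogeneous_system_nontrivial[OF _ _ this, of "\<lambda>k i. Q (u i) (e k)"]
  obtain c where c: "\<exists>i\<in>{..<n}. c i \<noteq> 0" "\<forall>k\<in>{..<r}. (\<Sum>i\<in>{..<n}. Q (u i) (e k) * c i) = 0"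
    by blast
  show ?thesis
  proof (intro exI[of _ c] conjI allI impI)
    show "\<exists>i<n. c i \<noteq> 0" using c by auto
    show "Q (\<Sum>i<n. c i *\<^sub>R u i) (e k) = 0" if "k < r" for k
      using c(2) that by (simp add: symmetric_formD(6,8)[OF Q] mult.commute)
  qed
qed

text \<open>Replaces Gram-Schmidt: if every orthonormal family were shorter than \<open>n\<close>,
  some nontrivial combination of the \<open>n\<close> given vectors would be orthogonal to a maximal
  one, hence both negative and nonnegative.\<close>

lemma negative_definite_imp_orthonormal:
  assumes Q: "symmetric_form Q" and nd: "negative_definite Q n"
  shows "\<exists>e. negative_orthonormal Q n e"
proof (rule ccontr)
  assume "\<nexists>e. negative_orthonormal Q n e"
  from maximal_negative_orthonormal[OF Q this]
  obtain r e where re: "r < n" "\<forall>w. (\<forall>i<r. Q w (e i) = 0) \<longrightarrow> Q w w \<ge> 0"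
    by blast
  from nd obtain u where u: "\<And>c. \<exists>i<n. c i \<noteq> 0 \<Longrightarrow> Q (\<Sum>i<n. c i *\<^sub>R u i) (\<Sum>i<n. c i *\<^sub>R u i) < 0"
    unfolding negative_definite_def by blast
  from combination_orthogonal[OF Q re(1), of u e]
  obtain c where c: "\<exists>i<n. c i \<noteq> 0" "\<forall>k<r. Q (\<Sum>i<n. c i *\<^sub>R u i) (e k) = 0" by blast
  from u[OF c(1)] re(2)[rule_format, of "\<Sum>i<n. c i *\<^sub>R u i"] c(2) show False by simp
qed

text \<open>Cauchy-Schwarz holds for the semidefinite form on the orthogonal complement. It extends
  to arbitrary \<open>x\<close> by projecting \<open>x\<close> there, which leaves its product with
  members of the complement unchanged. The second factor depends on \<open>x\<close> alone.\<close>

lemma not_negative_definite_split: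
  assumes Q: "symmetric_form Q" and "\<not> negative_definite Q n"
  shows "\<exists>r e. r < n \<and> (\<forall>w. (\<forall>i<r. Q w (e i) = 0) \<longrightarrow> Q w w \<ge> 0 \<and>
    (\<forall>x. (Q w x)\<^sup>2 \<le> Q w w * (Q x x + (\<Sum>i<r. (Q x (e i))\<^sup>2))))"
proof -
  have "\<nexists>e. negative_orthonormal Q n e"
    using assms negative_orthonormal_imp_negative_definite by blast
  from maximal_negative_orthonormal[OF Q this]
  obtain r e where re: "r < n" "negative_orthonormal Q r e"
     "\<forall>w. (\<forall>i<r. Q w (e i) = 0) \<longrightarrow> Q w w \<ge> 0"
    by blast
  note D = symmetric_formD[OF Q]
  have "(Q v x)\<^sup>2 \<le> Q v v * (Q x x + (\<Sum>i<r. (Q x (e i))\<^sup>2))"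
    if v: "\<And>i. i < r \<Longrightarrow> Q v (e i) = 0" for v x
  proof -
    \<comment> \<open>The projection carries a plus sign because \<open>Q (e i) (e i) = -1\<close>;
      for the same reason \<open>Q w w\<close> gains the squares.\<close>
    define w where "w = x + (\<Sum>i<r. Q x (e i) *\<^sub>R e i)"
    have we: "Q w (e k) = 0" if "k < r" for k
    proof -
      have "(\<Sum>i<r. Q x (e i) * Q (e i) (e k)) = (\<Sum>i<r. if i = k then - Q x (e i) else 0)"
        using re(2) that by (intro sum.cong) (auto simp: negative_orthonormal_def)
      then show ?thesis using that by (simp add: w_def D(2,6,8))
    qed
    have vw: "Q v w = Q v x" using v by (simp add: w_def D(3,7,9))
    have "Q w w = Q w x" by (subst (2) w_def) (simp add: D(3,7,9) we)
    also have "\<dots> = Q x x + (\<Sum>i<r. (Q x (e i))\<^sup>2)"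
    proof -
      have "Q (e i) x = Q x (e i)" for i by (rule D(1))
      then show ?thesis by (simp add: w_def D(2,6,8) power2_eq_square)
    qed
    finally have ww: "Q w w = Q x x + (\<Sum>i<r. (Q x (e i))\<^sup>2)" .
    have pos: "Q v v + 2 * t * Q v w + t\<^sup>2 * Q w w \<ge> 0" for t
    proof -
      have "Q (v + t *\<^sub>R w) (v + t *\<^sub>R w) \<ge> 0"
        by (rule re(3)[rule_format]) (simp add: D(2,6) v we)
      then show ?thesis by (simp add: D(2,3,6,7) D(1)[of w v] power2_eq_square algebra_simps)
    qed
    have "(Q v w)\<^sup>2 \<le> Q v v * Q w w"
    proof (cases "Q w w = 0")
      case True
      have "Q v w = 0"
      proof (rule ccontr)
        assume nz: "Q v w \<noteq> 0"
        \<comment> \<open>This choice of \<open>t\<close> gives the left side the value -1.\<close>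
        have "Q v v + 2 * (- (Q v v + 1) / (2 * Q v w)) * Q v w \<ge> 0" using pos[of "- (Q v v + 1) / (2 * Q v w)"] True by simp
        then show False using nz by (simp add: field_simps)
      qed
      with True show ?thesis by simp
    next
      case False
      moreover have "Q w w \<ge> 0" using re(3) we by simp
      ultimately have p: "Q w w > 0" by simp
      have "Q v v - (Q v w)\<^sup>2 / Q w w \<ge> 0"
        using pos[of "- Q v w / Q w w"] p by (simp add: power2_eq_square field_simps)
      then show ?thesis using p by (simp add: field_simps)
    qed
    then show ?thesis by (simp add: vw ww)
  qed
  then show ?thesis using re(1,3) by (intro exI[of _ r] exI[of _ e]) auto
qed

text \<open>The parameters with index below \<open>n\<close> form a closed set avoiding 0, and
  \<open>l\<close> is its infimum. At \<open>l\<close> the space \<open>W\<close> is cut out by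
  fewer than \<open>n\<close> conditions, so just below \<open>l\<close> every
  \<open>n\<close>-dimensional negative space meets it: this yields directions negative for
  \<open>Q (s j)\<close> on which \<open>Q l\<close> is nonnegative.\<close>

lemma index_jump:
  fixes Q :: "real \<Rightarrow> 'v::real_vector \<Rightarrow> 'v \<Rightarrow> real"
  assumes Q: "\<And>l. symmetric_form (Q l)"
    and cont: "\<And>v w. continuous_on {0..\<epsilon>} (\<lambda>l. Q l v w)"
    and "0 < \<epsilon>" and nd0: "negative_definite (Q 0) n" and nd1: "\<not> negative_definite (Q \<epsilon>) n"
  obtains l s v W C where "0 < l" "l \<le> \<epsilon>" "s \<longlonglongrightarrow> l" "\<And>j. 0 < s j \<and> s j \<le> \<epsilon>"
    "\<And>j. Q (s j) (v j) (v j) < 0" "\<And>j. v j \<in> W" "subspace W"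
    "\<And>w. w \<in> W \<Longrightarrow> Q l w w \<ge> 0"
    "\<And>w x. w \<in> W \<Longrightarrow> (Q l w x)\<^sup>2 \<le> Q l w w * C x"
proof -
  define S where "S = {l\<in>{0..\<epsilon>}. \<not> negative_definite (Q l) n}"
  have "openin (top_of_set {0..\<epsilon>}) {l\<in>{0..\<epsilon>}. negative_definite (Q l) n}"
  proof (subst openin_subopen, intro ballI)
    fix l0 assume "l0 \<in> {l\<in>{0..\<epsilon>}. negative_definite (Q l) n}"
    then have l0: "l0 \<in> {0..\<epsilon>}" "negative_definite (Q l0) n" by auto
    then obtain e where e: "negative_orthonormal (Q l0) n e"
      using negative_definite_imp_orthonormal[OF Q] by blast
    \<comment> \<open>The parameters at which the Gram matrix of the fixed family \<open>e\<close>
      stays close to minus the identity. The leading interval keeps \<open>T\<close> in range when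
      \<open>n = 0\<close> and the intersections are all of \<open>UNIV\<close>.\<close>
    define T where "T = {0..\<epsilon>} \<inter> (\<Inter>i<n. \<Inter>j<n. {l\<in>{0..\<epsilon>}. \<bar>Q l (e i) (e j) - (if i = j then -1 else 0)\<bar> \<in> {..<1 / (real n + 1)}})"
    have "openin (top_of_set {0..\<epsilon>}) {l\<in>{0..\<epsilon>}. \<bar>Q l (e i) (e j) - (if i = j then -1 else 0)\<bar> \<in> {..<1 / (real n + 1)}}" for i j
    proof -
      have "continuous_on {0..\<epsilon>} (\<lambda>l. \<bar>Q l (e i) (e j) - (if i = j then -1 else 0)\<bar>)"
        by (intro continuous_intros cont)
      from continuous_openin_preimage_gen[OF this, of "{..<1 / (real n + 1)}"]
      show ?thesis by (simp add: vimage_def Int_def)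
    qed
    then have "openin (top_of_set {0..\<epsilon>}) T"
      unfolding T_def by (cases "n = 0") (auto intro!: openin_Int openin_INT2)
    moreover have "l0 \<in> T" using l0 e by (auto simp: T_def negative_orthonormal_def)
    moreover have "T \<subseteq> {l\<in>{0..\<epsilon>}. negative_definite (Q l) n}"
      using negative_definite_perturb[OF Q, of n _ e] by (auto simp: T_def)
    ultimately show "\<exists>T. openin (top_of_set {0..\<epsilon>}) T \<and> l0 \<in> T \<and> T \<subseteq> {l\<in>{0..\<epsilon>}. negative_definite (Q l) n}"
      by blast
  qed
  then have "closedin (top_of_set {0..\<epsilon>}) ({0..\<epsilon>} - {l\<in>{0..\<epsilon>}. negative_definite (Q l) n})"
    by (intro closedin_diff) auto
  moreover have "{0..\<epsilon>} - {l\<in>{0..\<epsilon>}. negative_definite (Q l) n} = S" by (auto simp: S_def)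
  ultimately have "closed S" using closedin_closed_trans[of "{0..\<epsilon>}" S] by simp
  moreover have "S \<noteq> {}" using nd1 \<open>0 < \<epsilon>\<close> by (auto simp: S_def)
  moreover have bb: "bdd_below S" by (auto simp: S_def intro!: bdd_belowI[of _ 0])
  ultimately have inS: "Inf S \<in> S" by (intro closed_contains_Inf)
  define l where "l = Inf S"
  have l: "0 \<le> l" "l \<le> \<epsilon>" "\<not> negative_definite (Q l) n" using inS by (auto simp: l_def S_def)
  have "l \<noteq> 0" using l nd0 by metis
  with l have l0: "0 < l" by simp
  have below: "negative_definite (Q t) n" if "0 < t" "t < l" for t
  proof (rule ccontr)
    assume "\<not> ?thesis"
    then have "t \<in> S" using that l by (auto simp: S_def)
    then have "l \<le> t" unfolding l_def by (intro cInf_lower bb)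
    with that show False by simp
  qed
  from not_negative_definite_split[OF Q l(3)] obtain r e where re: "r < n"
    "\<forall>w. (\<forall>i<r. Q l w (e i) = 0) \<longrightarrow> Q l w w \<ge> 0 \<and>
      (\<forall>x. (Q l w x)\<^sup>2 \<le> Q l w w * (Q l x x + (\<Sum>i<r. (Q l x (e i))\<^sup>2)))"
    by auto
  define W where "W = {w. \<forall>i<r. Q l w (e i) = 0}"
  have sW: "subspace W"
    unfolding subspace_def W_def
    using symmetric_formD(6)[OF Q, of l 0 0] by (simp add: symmetric_formD(2,6)[OF Q])
  \<comment> \<open>Tends to \<open>l\<close> strictly from below; the 2 makes
    \<open>s 0 = l / 2\<close> positive.\<close>
  define s where "s = (\<lambda>j::nat. l * (1 - 1 / (real j + 2)))"
  have s: "0 < s j" "s j < l" for j using l0 by (auto simp: s_def field_simps intro: add_pos_nonneg)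
  have slim: "s \<longlonglongrightarrow> l"
  proof -
    have "(\<lambda>j::nat. 1 / (real j + 2)) \<longlonglongrightarrow> 0"
      using LIMSEQ_ignore_initial_segment[OF lim_1_over_n[where 'a=real], of 2] by (simp add: add.commute)
    then have "s \<longlonglongrightarrow> l * (1 - 0)" unfolding s_def by (intro tendsto_intros)
    then show ?thesis by simp
  qed
  have "\<exists>v. Q (s j) v v < 0 \<and> v \<in> W" for j
  proof -
    from below[OF s] obtain u where u: "\<And>c. \<exists>i<n. c i \<noteq> 0 \<Longrightarrow> Q (s j) (\<Sum>i<n. c i *\<^sub>R u i) (\<Sum>i<n. c i *\<^sub>R u i) < 0"
      unfolding negative_definite_def by blast
    from combination_orthogonal[OF Q re(1), of l u e]
    obtain c where c: "\<exists>i<n. c i \<noteq> 0" "\<forall>k<r. Q l (\<Sum>i<n. c i *\<^sub>R u i) (e k) = 0" by blast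
    from u[OF c(1)] c(2) show ?thesis by (auto simp: W_def)
  qed
  then obtain v where "\<And>j. Q (s j) (v j) (v j) < 0 \<and> v j \<in> W" by metis
  moreover have "Q l w w \<ge> 0" if "w \<in> W" for w
    using that re(2) by (simp add: W_def)
  moreover have "(Q l w x)\<^sup>2 \<le> Q l w w * (Q l x x + (\<Sum>i<r. (Q l x (e i))\<^sup>2))" if "w \<in> W" for w x
    using that re(2) by (simp add: W_def)
  moreover have "0 < s j \<and> s j \<le> \<epsilon>" for j using s[of j] l by auto
  ultimately show ?thesis using l0 l slim sW
    by (intro that[of l s v W "\<lambda>x. Q l x x + (\<Sum>i<r. (Q l x (e i))\<^sup>2)"]) auto
qed

section \<open>Weak derivatives and decay\<close>

text \<open>Within each of the three closed pieces the glued function has the right derivative if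
  \<open>x\<close> lies in the piece, and vacuously otherwise, because the filter is then trivial.
  The pieces cover the line, so the three limits combine.\<close>

lemma has_real_derivative_glue:
  fixes fL fM fR :: "real \<Rightarrow> real"
  assumes "b \<le> c"
    and L: "\<And>x. x \<le> b \<Longrightarrow> (fL has_real_derivative fL' x) (at x)"
    and M: "\<And>x. x \<in> {b..c} \<Longrightarrow> (fM has_real_derivative fM' x) (at x within {b..c})"
    and R: "\<And>x. c \<le> x \<Longrightarrow> (fR has_real_derivative fR' x) (at x)"
    and "fL b = fM b" "fL' b = fM' b" "fR c = fM c" "fR' c = fM' c"
  shows "((\<lambda>x. if x < b then fL x else if x \<le> c then fM x else fR x) has_real_derivative
    (if x < b then fL' x else if x \<le> c then fM' x else fR' x)) (at x)"
proof -
  define F where "F = (\<lambda>x. if x < b then fL x else if x \<le> c then fM x else fR x)"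
  define D where "D = (if x < b then fL' x else if x \<le> c then fM' x else fR' x)"
  have bot: "(F has_real_derivative D) (at x within S)" if "closed S" "x \<notin> S" for S
  proof -
    have "at x within S = bot" using that trivial_limit_within closed_limpt by blast
    then show ?thesis by (simp add: has_field_derivative_iff)
  qed
  have 1: "(F has_real_derivative D) (at x within {..b})"
  proof (cases "x \<le> b")
    case True
    have "(fL has_real_derivative D) (at x within {..b})"
      using DERIV_subset[OF L[OF True]] True assms by (auto simp: D_def)
    then show ?thesis
      by (rule has_field_derivative_transform_within[OF _ zero_less_one]) (use True assms in \<open>auto simp: F_def\<close>)
  qed (use bot in auto)
  have 2: "(F has_real_derivative D) (at x within {b..c})"
  proof (cases "x \<in> {b..c}")
    case True
    have "(fM has_real_derivative D) (at x within {b..c})"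
      using M[OF True] True by (auto simp: D_def)
    then show ?thesis
      by (rule has_field_derivative_transform_within[OF _ zero_less_one]) (use True in \<open>auto simp: F_def\<close>)
  qed (use bot in auto)
  have 3: "(F has_real_derivative D) (at x within {c..})"
  proof (cases "c \<le> x")
    case True
    have "(fR has_real_derivative D) (at x within {c..})"
      using DERIV_subset[OF R[OF True]] True assms by (auto simp: D_def split: if_splits)
    then show ?thesis
      by (rule has_field_derivative_transform_within[OF _ zero_less_one]) (use True assms in \<open>auto simp: F_def\<close>)
  qed (use bot in auto)
  have U: "{..b} \<union> {b..c} \<union> {c..} = UNIV" using assms(1) by auto
  have "(F has_real_derivative D) (at x within ({..b} \<union> {b..c} \<union> {c..}))"
    using 1 2 3 unfolding has_field_derivative_iff by (intro Lim_Un)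
  then have "(F has_real_derivative D) (at x)" unfolding U .
  then show ?thesis by (simp add: F_def D_def)
qed

text \<open>Dominated by the sum of two half-line exponentials, the left one being the reflection of
  the right one.\<close>

lemma integrable_exp_minus_abs:
  assumes "c > 0"
  shows "integrable lebesgue (\<lambda>x::real. exp (- c * \<bar>x\<bar>))"
proof -
  have m: "(\<lambda>x. indicat_real {0..} x * exp (- c * x)) \<in> borel_measurable lborel" by measurable
  have "set_integrable lebesgue {0..} (\<lambda>x. exp (- c * x))"
    by (intro nonnegative_absolutely_integrable_1 integrable_on_exp_minus_to_infinity assms) auto
  then have 1: "integrable lborel (\<lambda>x. indicat_real {0..} x * exp (- c * x))"
    using integrable_completion[OF m] by (simp add: set_integrable_def)
  have 2: "integrable lborel (\<lambda>x. indicat_real {0..} (- x) * exp (- c * (- x)))"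
    using lborel_integrable_real_affine[OF 1, of "-1" 0] by simp
  have "integrable lborel (\<lambda>x::real. exp (- c * \<bar>x\<bar>))"
  proof (rule Bochner_Integration.integrable_bound[OF Bochner_Integration.integrable_add[OF 1 2]])
    show "(\<lambda>x::real. exp (- c * \<bar>x\<bar>)) \<in> borel_measurable lborel" by measurable
  qed (auto simp: indicator_def)
  then show ?thesis by (subst integrable_completion) auto
qed

lemma L2_of_exponential_decay:
  fixes f :: "real \<Rightarrow> real"
  assumes f: "continuous_on UNIV f" and c: "c > 0"
    and bound: "\<And>x. \<bar>x\<bar> > b \<Longrightarrow> \<bar>f x\<bar> \<le> A * exp (- c * \<bar>x\<bar>)"
  shows "f \<in> L2"
proof -
  have mb: "f \<in> borel_measurable lborel"
    using borel_measurable_continuous_onI[OF f] by simp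
  have m: "f \<in> borel_measurable lebesgue" using measurable_completion[OF mb] .
  have "bounded (f ` {-b..b})"
    by (intro compact_imp_bounded compact_continuous_image continuous_on_subset[OF f]) auto
  then obtain B where B: "\<forall>x\<in>{-b..b}. \<bar>f x\<bar> \<le> B" unfolding bounded_iff by auto
  have "integrable lebesgue (\<lambda>x. (f x)\<^sup>2)"
  proof (rule Bochner_Integration.integrable_bound)
    have "set_integrable lebesgue {-b..b} (\<lambda>x::real. B\<^sup>2)"
      by (intro absolutely_integrable_continuous_real continuous_intros)
    then show "integrable lebesgue (\<lambda>x. indicat_real {-b..b} x * B\<^sup>2 + A\<^sup>2 * exp (- (2 * c) * \<bar>x\<bar>))"
      using integrable_exp_minus_abs[of "2 * c"] c
      by (intro Bochner_Integration.integrable_add integrable_mult_right) (auto simp: set_integrable_def)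
    show "(\<lambda>x. (f x)\<^sup>2) \<in> borel_measurable lebesgue" using m by measurable
    have "(f x)\<^sup>2 \<le> indicat_real {-b..b} x * B\<^sup>2 + A\<^sup>2 * exp (- (2 * c) * \<bar>x\<bar>)" for x
    proof (cases "x \<in> {-b..b}")
      case True
      then have "(f x)\<^sup>2 \<le> B\<^sup>2" using bspec[OF B True] by (metis abs_ge_zero power2_abs power_mono)
      then show ?thesis using True by (simp add: add_increasing2)
    next
      case False
      then have "\<bar>x\<bar> > b" by auto
      from power_mono[OF bound[OF this], of 2]
      have "(f x)\<^sup>2 \<le> A\<^sup>2 * (exp (- c * \<bar>x\<bar>))\<^sup>2" by (simp add: power_mult_distrib)
      also have "(exp (- c * \<bar>x\<bar>))\<^sup>2 = exp (- (2 * c) * \<bar>x\<bar>)"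
        by (simp add: power2_eq_square exp_add[symmetric])
      finally show ?thesis using False by simp
    qed
    then show "AE x in lebesgue. norm ((f x)\<^sup>2) \<le> norm (indicat_real {-b..b} x * B\<^sup>2 + A\<^sup>2 * exp (- (2 * c) * \<bar>x\<bar>))"
      by (intro AE_I2) (metis abs_ge_self abs_of_nonneg order_trans real_norm_def zero_le_power2)
  qed
  with m show ?thesis by (simp add: L2_def)
qed

section \<open>Classical derivatives as weak derivatives\<close>

lemma locally_integrable_continuous: "continuous_on UNIV u \<Longrightarrow> locally_integrable u"
  unfolding locally_integrable_def
  by (intro allI absolutely_integrable_continuous_real) (rule continuous_on_subset, auto)

lemma LINT_compact_support:
  fixes h :: "real \<Rightarrow> real"
  assumes h: "continuous_on UNIV h" and 0: "\<And>x. \<bar>x\<bar> > R \<Longrightarrow> h x = 0"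
  shows "(LINT x|lebesgue. h x) = integral {-R..R} h"
proof -
  have eq: "indicat_real {-R..R} x *\<^sub>R h x = h x" for x
    using 0[of x] by (cases "\<bar>x\<bar> > R") (auto simp: indicator_def abs_le_iff not_less)
  have s: "set_integrable lebesgue {-R..R} h"
    by (intro absolutely_integrable_continuous_real continuous_on_subset[OF h]) auto
  show "(LINT x|lebesgue. h x) = integral {-R..R} h"
    using set_lebesgue_integral_eq_integral(2)[OF s] by (simp only: set_lebesgue_integral_def eq)
qed

lemma test_function_deriv:
  assumes "test_function \<psi>"
  shows "((deriv ^^ m) \<psi> has_real_derivative (deriv ^^ Suc m) \<psi> x) (at x)"
  using assms by (simp add: test_function_def DERIV_deriv_iff_real_differentiable)

lemma test_function_continuous:
  assumes "test_function \<psi>"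
  shows "continuous_on S ((deriv ^^ m) \<psi>)"
  using test_function_deriv[OF assms] by (meson DERIV_isCont continuous_at_imp_continuous_on)

text \<open>One radius serves all orders: outside it the function vanishes on an open set, and so
  does each derivative.\<close>

lemma test_function_support:
  assumes "test_function \<psi>"
  shows "\<exists>R>0. \<forall>m x. \<bar>x\<bar> > R \<longrightarrow> (deriv ^^ m) \<psi> x = 0"
proof -
  have "bounded {x. \<psi> x \<noteq> 0}"
    using assms unfolding test_function_def
    by (metis bounded_subset closure_subset compact_imp_bounded)
  then obtain R where R: "R > 0" "\<And>x. \<psi> x \<noteq> 0 \<Longrightarrow> \<bar>x\<bar> \<le> R" unfolding bounded_pos by auto
  have "(deriv ^^ m) \<psi> x = 0" if "\<bar>x\<bar> > R" for m x
    using that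
  proof (induction m arbitrary: x)
    case 0
    then show ?case using R(2)[of x] by auto
  next
    case (Suc m)
    have "((deriv ^^ m) \<psi> has_real_derivative 0) (at x)"
    proof (rule has_field_derivative_transform_within_open[of "\<lambda>_. 0"])
      show "open {x::real. R < \<bar>x\<bar>}" by (intro open_Collect_less continuous_intros)
    qed (use Suc in auto)
    then show ?case by (simp add: DERIV_imp_deriv)
  qed
  with R(1) show ?thesis by blast
qed

lemma LINT_parts_test_function:
  assumes \<psi>: "test_function \<psi>"
    and f: "\<And>x. (f has_real_derivative f' x) (at x)" and f': "continuous_on UNIV f'"
  shows "(LINT x|lebesgue. f' x * (deriv ^^ j) \<psi> x) = - (LINT x|lebesgue. f x * (deriv ^^ Suc j) \<psi> x)"
proof -
  obtain R where R: "R > 0" "\<forall>m x. \<bar>x\<bar> > R \<longrightarrow> (deriv ^^ m) \<psi> x = 0"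
    using test_function_support[OF \<psi>] by blast
  have cf: "continuous_on UNIV f" using f by (meson DERIV_isCont continuous_at_imp_continuous_on)
  define u v where "u = (\<lambda>x. f' x * (deriv ^^ j) \<psi> x)" and "v = (\<lambda>x. f x * (deriv ^^ Suc j) \<psi> x)"
  have c: "continuous_on UNIV u" "continuous_on UNIV v"
    unfolding u_def v_def by (intro continuous_on_mult f' cf test_function_continuous[OF \<psi>])+
  have z: "u x = 0" "v x = 0" if "\<bar>x\<bar> > R + 1" for x
  proof -
    have "\<bar>x\<bar> > R" using that by simp
    then show "u x = 0" "v x = 0" unfolding u_def v_def using R(2) by (metis mult_zero_right)+
  qed
  \<comment> \<open>The endpoints are moved out to \<open>R + 1\<close> because vanishing is known
    only where the modulus strictly exceeds \<open>R\<close>.\<close>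
  have "((\<lambda>x. u x + v x) has_integral (f (R+1) * (deriv ^^ j) \<psi> (R+1) - f (-(R+1)) * (deriv ^^ j) \<psi> (-(R+1)))) {-(R+1)..R+1}"
  proof (rule fundamental_theorem_of_calculus)
    fix x
    have "((\<lambda>x. f x * (deriv ^^ j) \<psi> x) has_real_derivative u x + v x) (at x)"
      unfolding u_def v_def using DERIV_mult[OF f test_function_deriv[OF \<psi>, of j]]
      by (simp add: algebra_simps)
    then show "((\<lambda>x. f x * (deriv ^^ j) \<psi> x) has_vector_derivative u x + v x) (at x within {-(R+1)..R+1})"
      by (simp add: has_real_derivative_iff_has_vector_derivative has_vector_derivative_at_within)
  qed (use R in simp)
  moreover have "(deriv ^^ j) \<psi> (R+1) = 0" "(deriv ^^ j) \<psi> (-(R+1)) = 0" using R by auto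
  ultimately have "integral {-(R+1)..R+1} (\<lambda>x. u x + v x) = 0" by (simp add: integral_unique)
  moreover have "integral {-(R+1)..R+1} (\<lambda>x. u x + v x) = integral {-(R+1)..R+1} u + integral {-(R+1)..R+1} v"
    by (intro integral_add integrable_continuous_real continuous_on_subset[OF c(1)] continuous_on_subset[OF c(2)]) auto
  moreover have "(LINT x|lebesgue. u x) = integral {-(R+1)..R+1} u" "(LINT x|lebesgue. v x) = integral {-(R+1)..R+1} v"
    by (intro LINT_compact_support c z; simp)+
  ultimately show ?thesis by (simp add: u_def v_def)
qed

text \<open>Repeated integration by parts; the induction on \<open>m\<close> carries an arbitrary
  order \<open>j\<close> on the test function to absorb the derivatives already moved.\<close>

lemma weak_deriv_of_classical:
  assumes D: "\<And>i x. i < m \<Longrightarrow> (D i has_real_derivative D (Suc i) x) (at x)"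
    and c: "continuous_on UNIV (D m)"
  shows "weak_deriv m (D 0) (D m)"
proof -
  have cont: "continuous_on UNIV (D i)" if "i \<le> m" for i
  proof (cases "i = m")
    case False
    with that have "isCont (D i) x" for x using DERIV_isCont[OF D] by simp
    then show ?thesis by (simp add: continuous_at_imp_continuous_on)
  qed (use c in simp)
  have "(LINT x|lebesgue. D m x * (deriv ^^ j) \<psi> x) = (-1) ^ m * (LINT x|lebesgue. D 0 x * (deriv ^^ (m + j)) \<psi> x)"
    if "test_function \<psi>" for j \<psi>
    using D cont
  proof (induction m arbitrary: j)
    case (Suc m)
    have "(LINT x|lebesgue. D (Suc m) x * (deriv ^^ j) \<psi> x) = - (LINT x|lebesgue. D m x * (deriv ^^ Suc j) \<psi> x)"
      using Suc.prems by (intro LINT_parts_test_function that) auto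
    also have "(LINT x|lebesgue. D m x * (deriv ^^ Suc j) \<psi> x) = (-1) ^ m * (LINT x|lebesgue. D 0 x * (deriv ^^ (m + Suc j)) \<psi> x)"
      by (rule Suc.IH) (use Suc.prems in auto)
    finally show ?case by simp
  qed simp
  from this[of _ 0] show ?thesis
    unfolding weak_deriv_def using cont by (auto intro!: locally_integrable_continuous)
qed

text \<open>The set where \<open>f\<close> is nonzero is open, and a nonempty open set is not
  null.\<close>

lemma continuous_AE_zero:
  fixes f :: "real \<Rightarrow> real"
  assumes f: "continuous_on UNIV f" and "AE x in lebesgue. f x = 0"
  shows "f x = 0"
proof (rule ccontr)
  assume "f x \<noteq> 0"
  have "{x. f x \<noteq> 0} \<in> null_sets lebesgue"
  proof -
    have o: "open {x. f x \<noteq> 0}" by (intro open_Collect_neq f continuous_intros)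
    then have "{x. f x \<noteq> 0} \<in> sets lebesgue" by (simp add: borel_open)
    then show ?thesis using AE_iff_null[of lebesgue "\<lambda>x. f x = 0"] assms(2) by simp
  qed
  moreover have "open {x. f x \<noteq> 0}" by (intro open_Collect_neq f continuous_intros)
  ultimately show False using open_not_negligible[of "{x. f x \<noteq> 0}"] \<open>f x \<noteq> 0\<close>
    by (auto simp: negligible_iff_null_sets)
qed

section \<open>Calculus on a compact interval\<close>

lemma integral_Cauchy_Schwarz:
  fixes u w :: "real \<Rightarrow> real"
  assumes u: "continuous_on {a..b} u" and w: "continuous_on {a..b} w"
  shows "(integral {a..b} (\<lambda>x. u x * w x))\<^sup>2
    \<le> integral {a..b} (\<lambda>x. (u x)\<^sup>2) * integral {a..b} (\<lambda>x. (w x)\<^sup>2)"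
proof -
  define U V I where "U = integral {a..b} (\<lambda>x. (u x)\<^sup>2)" and "V = integral {a..b} (\<lambda>x. (w x)\<^sup>2)"
    and "I = integral {a..b} (\<lambda>x. u x * w x)"
  have iu: "((\<lambda>x. (u x)\<^sup>2) has_integral U) {a..b}" and iw: "((\<lambda>x. (w x)\<^sup>2) has_integral V) {a..b}"
    and ii: "((\<lambda>x. u x * w x) has_integral I) {a..b}"
    unfolding U_def V_def I_def
    by (intro integrable_integral integrable_continuous_real continuous_intros u w)+
  have pos: "t\<^sup>2 * U + 2 * t * s * I + s\<^sup>2 * V \<ge> 0" for t s
  proof -
    have "((\<lambda>x. t\<^sup>2 * (u x)\<^sup>2 + 2 * t * s * (u x * w x) + s\<^sup>2 * (w x)\<^sup>2) has_integral
        t\<^sup>2 * U + 2 * t * s * I + s\<^sup>2 * V) {a..b}"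
      by (intro has_integral_add has_integral_mult_right iu iw ii)
    then show ?thesis
    proof (rule has_integral_nonneg)
      fix x
      have "t\<^sup>2 * (u x)\<^sup>2 + 2 * t * s * (u x * w x) + s\<^sup>2 * (w x)\<^sup>2 = (t * u x + s * w x)\<^sup>2"
        by (simp add: power2_eq_square algebra_simps)
      then show "0 \<le> t\<^sup>2 * (u x)\<^sup>2 + 2 * t * s * (u x * w x) + s\<^sup>2 * (w x)\<^sup>2" by simp
    qed
  qed
  have UV: "U \<ge> 0" "V \<ge> 0" using pos[of 1 0] pos[of 0 1] by auto
  have "I\<^sup>2 \<le> U * V"
  proof (cases "V = 0")
    case False
    with UV have "V > 0" by simp
    \<comment> \<open>The nonnegative quadratic form at \<open>t = V\<close>, \<open>s = - I\<close>
      factors in this way.\<close>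
    moreover have "V * (U * V - I\<^sup>2) \<ge> 0"
      using pos[of V "- I"] by (simp add: power2_eq_square algebra_simps)
    ultimately show ?thesis by (simp add: zero_le_mult_iff)
  next
    case True
    show ?thesis
    proof (cases "I = 0")
      case False
      have "U + 2 * (- (U + 1) / (2 * I)) * I \<ge> 0" using pos[of 1 "- (U + 1) / (2 * I)"] True by simp
      then show ?thesis using False by (simp add: field_simps)
    qed (use UV in auto)
  qed
  then show ?thesis by (simp add: U_def V_def I_def)
qed

text \<open>The fundamental theorem and Cauchy-Schwarz against the constant 1. This Hoelder bound of
  exponent 1/2 drives both the equicontinuity and the grid estimate.\<close>

lemma C1_difference_bound:
  fixes f f' :: "real \<Rightarrow> real"
  assumes f: "\<And>x. x \<in> {a..b} \<Longrightarrow> (f has_real_derivative f' x) (at x within {a..b})"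
    and f': "continuous_on {a..b} f'" and xy: "x \<in> {a..b}" "y \<in> {a..b}"
  shows "(f x - f y)\<^sup>2 \<le> \<bar>x - y\<bar> * integral {a..b} (\<lambda>x. (f' x)\<^sup>2)"
proof -
  have *: "(f y - f x)\<^sup>2 \<le> (y - x) * integral {a..b} (\<lambda>x. (f' x)\<^sup>2)"
    if xy: "x \<in> {a..b}" "y \<in> {a..b}" "x \<le> y" for x y
  proof -
    have sub: "{x..y} \<subseteq> {a..b}" using xy by auto
    have "(f' has_integral (f y - f x)) {x..y}"
      using xy sub
      by (intro fundamental_theorem_of_calculus)
        (auto simp: has_real_derivative_iff_has_vector_derivative[symmetric] intro!: DERIV_subset[OF f])
    then have "f y - f x = integral {x..y} (\<lambda>t. 1 * f' t)" by (simp add: integral_unique)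
    then have "(f y - f x)\<^sup>2 \<le> integral {x..y} (\<lambda>x. 1\<^sup>2) * integral {x..y} (\<lambda>x. (f' x)\<^sup>2)"
      using integral_Cauchy_Schwarz[of x y "\<lambda>_. 1" f'] continuous_on_subset[OF f' sub] by simp
    also have "\<dots> \<le> (y - x) * integral {a..b} (\<lambda>x. (f' x)\<^sup>2)"
      using xy sub f'
      by (auto intro!: mult_left_mono integral_subset_le integrable_continuous_real continuous_intros
          intro: continuous_on_subset)
    finally show ?thesis .
  qed
  show ?thesis using *[of x y] *[of y x] xy by (cases "x \<le> y") (auto simp: power2_commute)
qed

text \<open>Integrate \<open>(f x)^2 \<le> 2 * (f y)^2 + 2 * (f x - f y)^2\<close> over
  \<open>y\<close>, bounding the last term by the difference estimate.\<close>

lemma C1_sup_bound: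
  fixes f f' :: "real \<Rightarrow> real"
  assumes f: "\<And>x. x \<in> {a..b} \<Longrightarrow> (f has_real_derivative f' x) (at x within {a..b})"
    and f': "continuous_on {a..b} f'" and x: "x \<in> {a..b}" and "a < b"
  shows "(f x)\<^sup>2 \<le> 2 / (b - a) * integral {a..b} (\<lambda>x. (f x)\<^sup>2) + 2 * (b - a) * integral {a..b} (\<lambda>x. (f' x)\<^sup>2)"
proof -
  define D where "D = integral {a..b} (\<lambda>x. (f' x)\<^sup>2)"
  have cf: "continuous_on {a..b} f" using f by (rule DERIV_continuous_on)
  have D: "D \<ge> 0" unfolding D_def
    by (intro integral_nonneg integrable_continuous_real continuous_intros f') auto
  have "integral {a..b} (\<lambda>y. (f x)\<^sup>2) \<le> integral {a..b} (\<lambda>y. 2 * (f y)\<^sup>2 + 2 * (b - a) * D)"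
  proof (rule integral_le)
    fix y assume y: "y \<in> {a..b}"
    have "(f x - f y)\<^sup>2 \<le> \<bar>x - y\<bar> * D"
      unfolding D_def by (rule C1_difference_bound[OF f f' x y])
    also have "\<dots> \<le> (b - a) * D" using x y D by (intro mult_right_mono) auto
    finally have 1: "(f x - f y)\<^sup>2 \<le> (b - a) * D" .
    have "0 \<le> (f x - 2 * f y)\<^sup>2" by simp
    with 1 show "(f x)\<^sup>2 \<le> 2 * (f y)\<^sup>2 + 2 * (b - a) * D"
      by (simp add: power2_eq_square algebra_simps)
  qed (intro integrable_continuous_real continuous_intros cf)+
  also have "\<dots> = integral {a..b} (\<lambda>y. 2 * (f y)\<^sup>2) + integral {a..b} (\<lambda>y. 2 * (b - a) * D)"
    by (intro integral_add integrable_continuous_real continuous_intros cf)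
  finally have "(b - a) * (f x)\<^sup>2 \<le> 2 * integral {a..b} (\<lambda>x. (f x)\<^sup>2) + 2 * (b - a) * D * (b - a)"
    using \<open>a < b\<close> by (simp add: mult.commute mult.left_commute)
  then show ?thesis using \<open>a < b\<close> by (simp add: D_def field_simps)
qed

section \<open>Limits under the integral\<close>

lemma tendsto_integral_uniform:
  fixes f :: "nat \<Rightarrow> real \<Rightarrow> real"
  assumes u: "uniform_limit {a..b} f h sequentially" and c: "\<And>n. continuous_on {a..b} (f n)"
  shows "(\<lambda>n. integral {a..b} (f n)) \<longlonglongrightarrow> integral {a..b} h"
proof -
  obtain I J where IJ: "\<And>n. (f n has_integral I n) {a..b}" "(h has_integral J) {a..b}" "I \<longlonglongrightarrow> J"
    using uniform_limit_integral[OF u c trivial_limit_sequentially] by blast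
  have "integral {a..b} (f n) = I n" "integral {a..b} h = J" for n
    using IJ by (auto intro: integral_unique)
  with IJ(3) show ?thesis by simp
qed

lemma tendsto_integral_uniform_mult:
  fixes f :: "nat \<Rightarrow> real \<Rightarrow> real"
  assumes u: "uniform_limit {a..b} f h sequentially" and c: "\<And>n. continuous_on {a..b} (f n)"
    and p: "continuous_on {a..b} p"
  shows "(\<lambda>n. integral {a..b} (\<lambda>x. p x * f n x)) \<longlonglongrightarrow> integral {a..b} (\<lambda>x. p x * h x)"
proof (rule tendsto_integral_uniform)
  have h: "continuous_on {a..b} h"
    by (rule uniform_limit_theorem[OF _ u]) (use c in auto)
  have "uniform_limit {a..b} (\<lambda>n::nat. p) p sequentially" by (simp add: uniform_limit_iff)
  then show "uniform_limit {a..b} (\<lambda>n x. p x * f n x) (\<lambda>x. p x * h x) sequentially"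
    using p h by (intro uniform_lim_mult u compact_imp_bounded compact_continuous_image) auto
  show "continuous_on {a..b} (\<lambda>x. p x * f n x)" for n by (intro continuous_intros p c)
qed

lemma tendsto_coeff_mult_bounded:
  fixes c F :: "nat \<Rightarrow> real"
  assumes "c \<longlonglongrightarrow> L" "\<And>n. \<bar>F n\<bar> \<le> M"
  shows "(\<lambda>n. (L - c n) * F n) \<longlonglongrightarrow> 0"
proof (rule lim_null_mult_right_bounded)
  have "(\<lambda>n. L - c n) \<longlonglongrightarrow> L - L" by (intro tendsto_intros assms(1))
  then show "(\<lambda>n. L - c n) \<longlonglongrightarrow> 0" by simp
  show "eventually (\<lambda>n. norm (F n) \<le> M) sequentially" using assms(2) by simp
qed

section \<open>The energy form\<close>

locale rayleigh_taylor =
  fixes g \<mu> k a :: real and \<rho> \<rho>' :: "real \<Rightarrow> real" and \<rho>\<^sub>m \<rho>\<^sub>p :: real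
  assumes g: "g > 0" and \<mu>: "\<mu> > 0" and k: "k > 0" and a: "a > 0"
    and rho_pos: "\<And>x. \<rho> x > 0"
    and rho_deriv: "\<And>x. (\<rho> has_real_derivative \<rho>' x) (at x)"
    and rho'_cont: "continuous_on UNIV \<rho>'"
    and rho'_nonneg: "\<And>x. \<rho>' x \<ge> 0"
    and rho_left: "\<And>x. x \<le> -a \<Longrightarrow> \<rho> x = \<rho>\<^sub>m"
    and rho_right: "\<And>x. x \<ge> a \<Longrightarrow> \<rho> x = \<rho>\<^sub>p"
    and rho_ne: "\<rho>\<^sub>m \<noteq> \<rho>\<^sub>p"

text \<open>A triple \<open>(p, q, h)\<close> encodes the function \<open>w\<close> of class \<open>C\<^sup>2\<close> on \<open>[-a, a]\<close> with
  \<open>w(-a) = p\<close>, \<open>w'(-a) = q\<close> and \<open>w'' = h\<close>.\<close>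

type_synonym C2 = "real \<times> real \<times> (real \<Rightarrow>\<^sub>C real)"

context rayleigh_taylor
begin

text \<open>Encoding by initial values and second derivative makes \<open>C2\<close> a type of class
  \<open>real_vector\<close>, so the abstract index argument applies without carrier sets, and
  \<open>d0\<close>, \<open>d1\<close>, \<open>d2\<close> are linear in \<open>w\<close>.\<close>

definition d2 :: "C2 \<Rightarrow> real \<Rightarrow> real" where
  "d2 w = apply_bcontfun (snd (snd w))"

definition d1 :: "C2 \<Rightarrow> real \<Rightarrow> real" where
  "d1 w x = fst (snd w) + integral {-a..x} (d2 w)"

definition d0 :: "C2 \<Rightarrow> real \<Rightarrow> real" where
  "d0 w x = fst w + integral {-a..x} (d1 w)"

lemma d2_continuous [continuous_intros]: "continuous_on S (d2 w)"
  by (simp add: d2_def)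

lemma d1_deriv: "x \<in> {-a..b} \<Longrightarrow> (d1 w has_real_derivative d2 w x) (at x within {-a..b})"
  unfolding d1_def by (auto intro!: derivative_eq_intros integral_has_real_derivative d2_continuous)

lemma d1_continuous [continuous_intros]: "continuous_on {-a..b} (d1 w)"
  using d1_deriv by (rule DERIV_continuous_on)

lemma d0_deriv: "x \<in> {-a..b} \<Longrightarrow> (d0 w has_real_derivative d1 w x) (at x within {-a..b})"
  unfolding d0_def by (auto intro!: derivative_eq_intros integral_has_real_derivative d1_continuous)

lemma d0_continuous [continuous_intros]: "continuous_on {-a..b} (d0 w)"
  using d0_deriv by (rule DERIV_continuous_on)

lemma d2_add: "d2 (v + w) x = d2 v x + d2 w x" and d2_scale: "d2 (c *\<^sub>R w) x = c * d2 w x"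
  by (simp_all add: d2_def plus_bcontfun.rep_eq scaleR_bcontfun.rep_eq)

lemma d1_add: "d1 (v + w) x = d1 v x + d1 w x" and d1_scale: "d1 (c *\<^sub>R w) x = c * d1 w x"
proof -
  have "integral {-a..x} (d2 (v + w)) = integral {-a..x} (d2 v) + integral {-a..x} (d2 w)"
    unfolding d2_add[abs_def] by (intro integral_add integrable_continuous_real continuous_intros)
  then show "d1 (v + w) x = d1 v x + d1 w x" by (simp add: d1_def)
  show "d1 (c *\<^sub>R w) x = c * d1 w x"
    by (simp add: d1_def d2_scale[abs_def] algebra_simps)
qed

lemma d0_add: "d0 (v + w) x = d0 v x + d0 w x" and d0_scale: "d0 (c *\<^sub>R w) x = c * d0 w x"
proof -
  have "integral {-a..x} (d1 (v + w)) = integral {-a..x} (d1 v) + integral {-a..x} (d1 w)"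
    unfolding d1_add[abs_def] by (intro integral_add integrable_continuous_real continuous_intros)
  then show "d0 (v + w) x = d0 v x + d0 w x" by (simp add: d0_def)
  show "d0 (c *\<^sub>R w) x = c * d0 w x"
    by (simp add: d0_def d1_scale[abs_def] algebra_simps)
qed

lemma linear_d0: "linear (\<lambda>w. d0 w x)"
  by (intro linearI) (simp_all add: d0_add d0_scale)

lemma d_diff: "d0 (v - w) x = d0 v x - d0 w x" "d1 (v - w) x = d1 v x - d1 w x" "d2 (v - w) x = d2 v x - d2 w x"
  using d0_add[of "v - w" w x] d1_add[of "v - w" w x] d2_add[of "v - w" w x] by simp_all

text \<open>Extend \<open>f''\<close> to a bounded continuous function on the line; integrating from
  \<open>-a\<close> recovers \<open>f'\<close> and \<open>f\<close>.\<close>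

lemma C2_of_function:
  fixes f f' f'' :: "real \<Rightarrow> real"
  assumes f: "\<And>x. x \<in> {-a..a} \<Longrightarrow> (f has_real_derivative f' x) (at x within {-a..a})"
    and f': "\<And>x. x \<in> {-a..a} \<Longrightarrow> (f' has_real_derivative f'' x) (at x within {-a..a})"
    and f'': "continuous_on {-a..a} f''"
  shows "\<exists>w. \<forall>x\<in>{-a..a}. d0 w x = f x \<and> d1 w x = f' x \<and> d2 w x = f'' x"
proof -
  obtain h :: "real \<Rightarrow>\<^sub>C real" where h: "\<And>x. x \<in> cbox (-a) a \<Longrightarrow> h x = f'' x"
    using continuous_on_cbox_bcontfunE[of "-a" a f''] f'' by (metis cbox_interval)
  define w where "w = (f (-a), f' (-a), h)"
  have ftc: "f x = f (-a) + integral {-a..x} f'"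
    if x: "x \<in> {-a..a}" and f: "\<And>x. x \<in> {-a..a} \<Longrightarrow> (f has_real_derivative f' x) (at x within {-a..a})"
    for x and f f' :: "real \<Rightarrow> real"
  proof -
    have "(f' has_integral (f x - f (-a))) {-a..x}"
      using x by (intro fundamental_theorem_of_calculus)
        (auto simp: has_real_derivative_iff_has_vector_derivative[symmetric] intro!: DERIV_subset[OF f])
    then show ?thesis by (simp add: integral_unique)
  qed
  have 2: "d2 w x = f'' x" if "x \<in> {-a..a}" for x
    using h that by (simp add: d2_def w_def cbox_interval)
  have 1: "d1 w x = f' x" if x: "x \<in> {-a..a}" for x
  proof -
    have "integral {-a..x} (d2 w) = integral {-a..x} f''" by (rule integral_cong) (use x 2 in auto)
    then show ?thesis using ftc[OF x f'] by (simp add: d1_def w_def)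
  qed
  have 0: "d0 w x = f x" if x: "x \<in> {-a..a}" for x
  proof -
    have "integral {-a..x} (d1 w) = integral {-a..x} f'" by (rule integral_cong) (use x 1 in auto)
    then show ?thesis using ftc[OF x f] by (simp add: d0_def w_def)
  qed
  from 0 1 2 show ?thesis by blast
qed

section \<open>Weighted inner products and the form on the interval\<close>

definition ip :: "(real \<Rightarrow> real) \<Rightarrow> (real \<Rightarrow> real) \<Rightarrow> (real \<Rightarrow> real) \<Rightarrow> real" where
  "ip p u w = integral {-a..a} (\<lambda>x. p x * u x * w x)"

lemma ip_commute: "ip p u w = ip p w u"
  by (simp add: ip_def mult.commute mult.left_commute)

lemma ip_add:
  assumes "continuous_on {-a..a} p" "continuous_on {-a..a} u" "continuous_on {-a..a} v" "continuous_on {-a..a} w"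
  shows "ip p u (\<lambda>x. v x + w x) = ip p u v + ip p u w"
  unfolding ip_def ring_distribs
  by (intro integral_add integrable_continuous_real continuous_intros assms)

lemma ip_scale: "ip p u (\<lambda>x. c * w x) = c * ip p u w"
  unfolding ip_def by (subst integral_mult_right[symmetric]) (simp add: algebra_simps)

lemma ip_nonneg:
  assumes "continuous_on {-a..a} p" "continuous_on {-a..a} u" "\<And>x. p x \<ge> 0"
  shows "ip p u u \<ge> 0"
  unfolding ip_def using assms
  by (intro integral_nonneg integrable_continuous_real continuous_intros) (auto simp: mult.assoc)

lemma ip_mono:
  assumes "continuous_on {-a..a} p" "continuous_on {-a..a} u" "\<And>x. x \<in> {-a..a} \<Longrightarrow> p x \<le> M"
  shows "ip p u u \<le> M * ip (\<lambda>_. 1) u u"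
proof -
  have "ip p u u \<le> integral {-a..a} (\<lambda>x. M * (1 * u x * u x))"
    unfolding ip_def using assms
    by (intro integral_le integrable_continuous_real continuous_intros)
      (auto simp: mult.assoc intro: mult_right_mono)
  then show ?thesis by (simp add: ip_def)
qed

lemma rho_continuous: "continuous_on S \<rho>"
  using rho_deriv by (meson DERIV_isCont continuous_at_imp_continuous_on)

lemma rho'_continuous: "continuous_on S \<rho>'"
  using rho'_cont continuous_on_subset by blast

abbreviation energy0 :: "C2 \<Rightarrow> C2 \<Rightarrow> real" where
  "energy0 v w \<equiv> ip (\<lambda>_. 1) (d0 v) (d0 w)"
abbreviation energy1 :: "C2 \<Rightarrow> C2 \<Rightarrow> real" where
  "energy1 v w \<equiv> ip (\<lambda>_. 1) (d1 v) (d1 w)"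
abbreviation energy2 :: "C2 \<Rightarrow> C2 \<Rightarrow> real" where
  "energy2 v w \<equiv> ip (\<lambda>_. 1) (d2 v) (d2 w)"

definition buoyancy :: "C2 \<Rightarrow> C2 \<Rightarrow> real" where
  "buoyancy v w = ip \<rho>' (d0 v) (d0 w)"

text \<open>Up to the factor \<open>\<mu>\<close>, \<open>bd t s\<close> is the energy on a half line of the decaying solutions of
  \<open>(D\<^sup>2 - k\<^sup>2)(D\<^sup>2 - t\<^sup>2)u = 0\<close> with given boundary values of \<open>u\<close> and \<open>u'\<close>;
  \<open>s = 1\<close> for the right half line and \<open>s = -1\<close> for the left one.\<close>

definition bd :: "real \<Rightarrow> real \<Rightarrow> real \<Rightarrow> real \<Rightarrow> real \<Rightarrow> real \<Rightarrow> real" where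
  "bd t s x0 x1 y0 y1 = (k + t) * x1 * y1 + s * k * t * (x0 * y1 + x1 * y0) + k * t * (k + t) * x0 * y0"

text \<open>Where the density has the constant value \<open>r\<close>, the equation factors as
  \<open>(D^2 - k^2) (D^2 - \<tau>^2) u = 0\<close>; this is the second decay rate.\<close>

definition \<tau> :: "real \<Rightarrow> real \<Rightarrow> real" where
  "\<tau> l r = sqrt (k\<^sup>2 + l * r / \<mu>)"

text \<open>The equation tested with \<open>w\<close>, each half line being replaced by its boundary
  energy \<open>bd\<close>. For \<open>l \<ge> 0\<close> every diagonal term except the buoyancy is
  nonnegative, and at \<open>l = 0\<close> the buoyancy alone survives.\<close>

definition Q :: "real \<Rightarrow> C2 \<Rightarrow> C2 \<Rightarrow> real" where
  "Q l v w = l * \<mu> * (energy2 v w + 2 * k\<^sup>2 * energy1 v w + k ^ 4 * energy0 v w)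
     + l\<^sup>2 * (ip \<rho> (d1 v) (d1 w) + k\<^sup>2 * ip \<rho> (d0 v) (d0 w))
     - g * k\<^sup>2 * buoyancy v w
     + l * \<mu> * (bd (\<tau> l \<rho>\<^sub>p) 1 (d0 v a) (d1 v a) (d0 w a) (d1 w a)
              + bd (\<tau> l \<rho>\<^sub>m) (-1) (d0 v (-a)) (d1 v (-a)) (d0 w (-a)) (d1 w (-a)))"

text \<open>Completing squares. It gives positivity for positive \<open>t\<close> and separates the
  powers of \<open>t\<close> from the boundary values, which \<open>Q_perturbation\<close>
  exploits.\<close>

lemma bd_diag: "s\<^sup>2 = 1 \<Longrightarrow> bd t s x0 x1 x0 x1 = k * x1\<^sup>2 + t * (x1 + s * k * x0)\<^sup>2 + k * t\<^sup>2 * x0\<^sup>2"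
  unfolding bd_def power2_sum power_mult_distrib by (simp add: power2_eq_square algebra_simps)

lemma rho_const_pos: "\<rho>\<^sub>m > 0" "\<rho>\<^sub>p > 0"
  using rho_pos[of a] rho_pos[of "-a"] rho_left[of "-a"] rho_right[of a] by auto

lemma \<tau>_pos: "l \<ge> 0 \<Longrightarrow> r > 0 \<Longrightarrow> \<tau> l r > 0"
  using k \<mu> by (simp add: \<tau>_def add_pos_nonneg)

lemma bd_nonneg: "l \<ge> 0 \<Longrightarrow> r > 0 \<Longrightarrow> s\<^sup>2 = 1 \<Longrightarrow> bd (\<tau> l r) s x0 x1 x0 x1 \<ge> 0"
  using k \<tau>_pos[of l r] by (simp add: bd_diag)

lemma symmetric_ip_d:
  assumes "continuous_on {-a..a} p"
  shows "symmetric_form (\<lambda>v w. ip p (d0 v) (d0 w))" "symmetric_form (\<lambda>v w. ip p (d1 v) (d1 w))"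
    "symmetric_form (\<lambda>v w. ip p (d2 v) (d2 w))"
  unfolding symmetric_form_def
  by (intro conjI allI linearI ip_commute;
      simp only: d0_add[abs_def] d1_add[abs_def] d2_add[abs_def] d0_scale[abs_def] d1_scale[abs_def]
        d2_scale[abs_def] ip_scale real_scaleR_def; intro ip_add continuous_intros assms)+

lemma symmetric_buoyancy: "symmetric_form buoyancy"
  unfolding buoyancy_def[abs_def] by (intro symmetric_ip_d rho'_continuous)

lemma symmetric_Q: "symmetric_form (Q l)"
proof -
  note S = symmetric_ip_d[of "\<lambda>_. 1", OF continuous_on_const] symmetric_ip_d[OF rho_continuous]
  note A = S[THEN symmetric_formD(3)] symmetric_formD(3)[OF symmetric_buoyancy]
  note B = S[THEN symmetric_formD(7)] symmetric_formD(7)[OF symmetric_buoyancy]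
  show ?thesis
    unfolding symmetric_form_def
  proof (intro conjI allI linearI)
    show "Q l v w = Q l w v" for v w
      unfolding Q_def bd_def buoyancy_def
      by (simp add: ip_commute[of _ "d0 v"] ip_commute[of _ "d1 v"] ip_commute[of _ "d2 v"] mult.commute mult.left_commute add.commute)
    show "Q l v (w + w') = Q l v w + Q l v w'" for v w w'
      unfolding Q_def bd_def A d0_add d1_add by (simp add: algebra_simps)
    show "Q l v (c *\<^sub>R w) = c *\<^sub>R Q l v w" for v w c
      unfolding Q_def bd_def B d0_scale d1_scale by (simp add: algebra_simps)
  qed
qed

lemma Q_continuous: "continuous_on S (\<lambda>l. Q l v w)"
  unfolding Q_def bd_def \<tau>_def by (intro continuous_intros) (use \<mu> in auto)

section \<open>Coercivity and pointwise bounds\<close>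

definition sobolev_norm2 :: "C2 \<Rightarrow> real" where
  "sobolev_norm2 w = energy0 w w + energy1 w w + energy2 w w"

lemma energy_nonneg: "energy0 w w \<ge> 0" "energy1 w w \<ge> 0" "energy2 w w \<ge> 0"
  by (intro ip_nonneg continuous_intros; simp)+

lemma buoyancy_nonneg: "buoyancy w w \<ge> 0"
  unfolding buoyancy_def by (intro ip_nonneg rho'_continuous continuous_intros rho'_nonneg)

lemma Q_lower:
  assumes "l \<ge> 0"
  shows "Q l w w + g * k\<^sup>2 * buoyancy w w \<ge> l * \<mu> * (energy2 w w + 2 * k\<^sup>2 * energy1 w w + k ^ 4 * energy0 w w)"
proof -
  have "0 \<le> l\<^sup>2 * (ip \<rho> (d1 w) (d1 w) + k\<^sup>2 * ip \<rho> (d0 w) (d0 w))"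
    by (intro mult_nonneg_nonneg add_nonneg_nonneg ip_nonneg rho_continuous continuous_intros less_imp_le[OF rho_pos]) auto
  moreover have "0 \<le> l * \<mu> * (bd (\<tau> l \<rho>\<^sub>p) 1 (d0 w a) (d1 w a) (d0 w a) (d1 w a)
              + bd (\<tau> l \<rho>\<^sub>m) (-1) (d0 w (-a)) (d1 w (-a)) (d0 w (-a)) (d1 w (-a)))"
    using assms \<mu> by (intro mult_nonneg_nonneg add_nonneg_nonneg bd_nonneg rho_const_pos) auto
  ultimately show ?thesis unfolding Q_def by linarith
qed

definition coercivity :: real where "coercivity = \<mu> * min 1 (min (2 * k\<^sup>2) (k ^ 4))"

lemma coercivity_pos: "coercivity > 0"
  using k \<mu> by (simp add: coercivity_def)

text \<open>A Garding inequality, with the buoyancy as the compact correction. Its constant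
  degenerates linearly as \<open>l\<close> tends to 0, so uniform bounds require parameters bounded
  away from 0.\<close>

lemma Q_coercive:
  assumes "l \<ge> 0"
  shows "l * coercivity * sobolev_norm2 w \<le> Q l w w + g * k\<^sup>2 * buoyancy w w"
proof -
  let ?m = "min 1 (min (2 * k\<^sup>2) (k ^ 4))"
  have "?m * sobolev_norm2 w \<le> energy2 w w + 2 * k\<^sup>2 * energy1 w w + k ^ 4 * energy0 w w"
  proof -
    have "?m * energy2 w w \<le> 1 * energy2 w w" "?m * energy1 w w \<le> 2 * k\<^sup>2 * energy1 w w"
        "?m * energy0 w w \<le> k ^ 4 * energy0 w w"
      by (intro mult_right_mono energy_nonneg; simp)+
    then show ?thesis unfolding sobolev_norm2_def ring_distribs by linarith
  qed
  then have "l * \<mu> * (?m * sobolev_norm2 w) \<le> l * \<mu> * (energy2 w w + 2 * k\<^sup>2 * energy1 w w + k ^ 4 * energy0 w w)"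
    using assms \<mu> by (intro mult_left_mono) auto
  then show ?thesis using Q_lower[OF assms, of w] by (simp add: coercivity_def mult.assoc)
qed

lemma d0_holder: "x \<in> {-a..a} \<Longrightarrow> y \<in> {-a..a} \<Longrightarrow> (d0 w x - d0 w y)\<^sup>2 \<le> \<bar>x - y\<bar> * energy1 w w"
  using C1_difference_bound[where f="d0 w" and f'="d1 w" and a="-a" and b=a, OF d0_deriv d1_continuous]
  by (simp add: ip_def power2_eq_square)

text \<open>One-dimensional Sobolev embedding: \<open>C1_sup_bound\<close> on an interval of length
  \<open>2 * a\<close> gives the factors \<open>2 / (2 * a)\<close> and
  \<open>2 * (2 * a)\<close>.\<close>

lemma d_sup:
  assumes x: "x \<in> {-a..a}"
  shows "(d0 w x)\<^sup>2 \<le> (1 / a + 4 * a) * sobolev_norm2 w" "(d1 w x)\<^sup>2 \<le> (1 / a + 4 * a) * sobolev_norm2 w"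
proof -
  have ineq: "1 / a * x + 4 * a * y \<le> (1 / a + 4 * a) * (x + y + z)" if "x \<ge> 0" "y \<ge> 0" "z \<ge> 0" for x y z :: real
  proof -
    have "(1 / a + 4 * a) * (x + y + z) - (1 / a * x + 4 * a * y) = 1 / a * (y + z) + 4 * a * (x + z)"
      by (simp add: algebra_simps add_divide_distrib)
    also have "\<dots> \<ge> 0" using that a by simp
    finally show ?thesis by simp
  qed
  have "(d0 w x)\<^sup>2 \<le> 1 / a * energy0 w w + 4 * a * energy1 w w"
    using C1_sup_bound[OF d0_deriv d1_continuous x] a by (simp add: ip_def power2_eq_square)
  also have "\<dots> \<le> (1 / a + 4 * a) * sobolev_norm2 w"
    unfolding sobolev_norm2_def by (intro ineq energy_nonneg)
  finally show "(d0 w x)\<^sup>2 \<le> (1 / a + 4 * a) * sobolev_norm2 w" .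
  have "(d1 w x)\<^sup>2 \<le> 1 / a * energy1 w w + 4 * a * energy2 w w"
    using C1_sup_bound[OF d1_deriv d2_continuous x] a by (simp add: ip_def power2_eq_square)
  also have "\<dots> \<le> (1 / a + 4 * a) * (energy1 w w + energy2 w w + energy0 w w)"
    by (intro ineq energy_nonneg)
  finally show "(d1 w x)\<^sup>2 \<le> (1 / a + 4 * a) * sobolev_norm2 w" by (simp add: sobolev_norm2_def algebra_simps)
qed

lemma d0_sum: "d0 (\<Sum>i<n. c i *\<^sub>R u i) x = (\<Sum>i<n. c i * d0 (u i) x)"
  using linear_sum[OF linear_d0, where g="\<lambda>i. c i *\<^sub>R u i" and S="{..<n}"] by (simp add: d0_scale)

section \<open>The index: finite for positive parameters, unbounded at zero\<close>

lemma rho'_bounded: "\<exists>M>0. \<forall>x\<in>{-a..a}. \<rho>' x \<le> M"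
proof -
  have "bounded (\<rho>' ` {-a..a})"
    by (intro compact_imp_bounded compact_continuous_image rho'_continuous) auto
  then obtain M where "M > 0" "\<forall>y\<in>\<rho>' ` {-a..a}. norm y \<le> M" unfolding bounded_pos by blast
  then show ?thesis by force
qed

lemma rho_bounded: "\<exists>M>0. \<forall>x\<in>{-a..a}. \<rho> x \<le> M"
proof -
  have "bounded (\<rho> ` {-a..a})"
    by (intro compact_imp_bounded compact_continuous_image rho_continuous) auto
  then obtain M where "M > 0" "\<forall>y\<in>\<rho> ` {-a..a}. norm y \<le> M" unfolding bounded_pos by blast
  then show ?thesis by force
qed

text \<open>A function vanishing on a sufficiently fine grid has nonnegative energy by a Poincare
  inequality, so the number of grid points bounds the index of the form.\<close>

lemma finite_index:
  assumes "l > 0"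
  shows "\<exists>n. \<not> negative_definite (Q l) n"
proof -
  obtain M where M: "M > 0" "\<forall>x\<in>{-a..a}. \<rho>' x \<le> M" using rho'_bounded by blast
  \<comment> \<open>Chosen so that the Poincare constant \<open>4 * a^2 / K\<close>, multiplied by
    \<open>g * k^2 * M\<close>, is absorbed by the coefficient \<open>2 * k^2 * l * \<mu>\<close> of
    \<open>energy1\<close>.\<close>
  obtain K :: nat where K: "real K > max 1 (2 * g * M * a\<^sup>2 / (l * \<mu>))"
    using reals_Archimedean2 by blast
  then have K0: "real K > 0" and K1: "2 * g * M * a\<^sup>2 \<le> l * \<mu> * real K"
    using assms \<mu> by (auto simp: field_simps)
  define p where "p = (\<lambda>i::nat. - a + 2 * a * real i / real K)"
  have p: "p i \<in> {-a..a}" if "i \<le> K" for i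
  proof -
    have "2 * a * real i \<le> 2 * a * real K" using that a by simp
    then show ?thesis using a K0 by (simp add: p_def field_simps)
  qed
  have grid: "\<exists>i\<le>K. \<bar>x - p i\<bar> \<le> 2 * a / real K" if x: "x \<in> {-a..a}" for x
  proof -
    define y where "y = (x + a) * real K / (2 * a)"
    have "(x + a) * real K \<le> 2 * a * real K" using x by (intro mult_right_mono) auto
    then have y: "0 \<le> y" "y \<le> real K" using x a by (auto simp: y_def divide_le_eq mult.commute)
    define i where "i = nat \<lfloor>y\<rfloor>"
    have i: "real i \<le> y" "y < real i + 1" using y by (auto simp: i_def)
    have "i \<le> K" using y by (simp add: i_def nat_le_iff floor_le_iff)
    moreover have "x - p i = 2 * a / real K * (y - real i)"
      using a K0 by (simp add: p_def y_def field_simps)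
    moreover have "\<bar>2 * a / real K * (y - real i)\<bar> \<le> 2 * a / real K * 1"
      unfolding abs_mult using i a K0 by (intro mult_mono) auto
    ultimately show ?thesis by auto
  qed
  \<comment> \<open>The points \<open>p 0\<close>, ..., \<open>p K\<close> impose
    \<open>K + 1\<close> linear conditions, so among \<open>K + 2\<close> directions a nontrivial
    combination vanishes on the grid.\<close>
  have "\<not> negative_definite (Q l) (K + 2)"
  proof
    assume "negative_definite (Q l) (K + 2)"
    then obtain u where u: "\<And>c. \<exists>i<K+2. c i \<noteq> 0 \<Longrightarrow> Q l (\<Sum>i<K+2. c i *\<^sub>R u i) (\<Sum>i<K+2. c i *\<^sub>R u i) < 0"
      unfolding negative_definite_def by blast
    have "card {..K} < card {..<K+2}" by simp
    from homogeneous_system_nontrivial[OF _ _ this, of "\<lambda>j i. d0 (u i) (p j)"]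
    obtain c where c: "\<exists>i\<in>{..<K+2}. c i \<noteq> 0" "\<forall>j\<in>{..K}. (\<Sum>i\<in>{..<K+2}. d0 (u i) (p j) * c i) = 0"
      by blast
    define w where "w = (\<Sum>i<K+2. c i *\<^sub>R u i)"
    have neg: "Q l w w < 0" using u[of c] c(1) by (auto simp: w_def)
    have zero: "d0 w (p j) = 0" if "j \<le> K" for j
      using c(2) that unfolding w_def d0_sum by (simp add: mult.commute)
    have sup: "(d0 w x)\<^sup>2 \<le> 2 * a / real K * energy1 w w" if x: "x \<in> {-a..a}" for x
    proof -
      obtain i where i: "i \<le> K" "\<bar>x - p i\<bar> \<le> 2 * a / real K" using grid[OF x] by blast
      have "(d0 w x)\<^sup>2 = (d0 w x - d0 w (p i))\<^sup>2" using zero[OF i(1)] by simp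
      also have "\<dots> \<le> \<bar>x - p i\<bar> * energy1 w w" by (rule d0_holder[OF x p[OF i(1)]])
      also have "\<dots> \<le> 2 * a / real K * energy1 w w"
        by (intro mult_right_mono i energy_nonneg)
      finally show ?thesis .
    qed
    have "buoyancy w w \<le> M * energy0 w w"
      unfolding buoyancy_def by (intro ip_mono rho'_continuous continuous_intros) (use M in auto)
    also have "energy0 w w \<le> integral {-a..a} (\<lambda>x. 2 * a / real K * energy1 w w)"
      unfolding ip_def[of _ "d0 w"]
      by (intro integral_le integrable_continuous_real continuous_intros)
        (use sup in \<open>auto simp: power2_eq_square\<close>)
    also have "\<dots> = 4 * a\<^sup>2 / real K * energy1 w w" using a by (simp add: power2_eq_square)
    finally have b: "buoyancy w w \<le> M * (4 * a\<^sup>2 / real K * energy1 w w)" using M by simp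
    have "g * k\<^sup>2 * buoyancy w w \<le> g * k\<^sup>2 * (M * (4 * a\<^sup>2 / real K * energy1 w w))"
      using g by (intro mult_left_mono b) auto
    also have "\<dots> = 2 * k\<^sup>2 * energy1 w w * ((2 * g * M * a\<^sup>2) / real K)" by (simp add: algebra_simps)
    also have "\<dots> \<le> 2 * k\<^sup>2 * energy1 w w * (l * \<mu>)"
      using K0 K1 energy_nonneg(2)[of w] by (intro mult_left_mono) (auto simp: divide_le_eq)
    also have "\<dots> \<le> l * \<mu> * (energy2 w w + 2 * k\<^sup>2 * energy1 w w + k ^ 4 * energy0 w w)"
      using assms \<mu> energy_nonneg[of w] by (simp add: algebra_simps)
    also have "\<dots> \<le> Q l w w + g * k\<^sup>2 * buoyancy w w" by (intro Q_lower) (use assms in auto)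
    finally show False using neg by simp
  qed
  then show ?thesis by blast
qed

text \<open>The density differs at the two ends, so the mean value theorem gives an interior point
  with positive derivative; continuity spreads this to an interval on its right.\<close>

lemma rho'_pos_interval: "\<exists>c d. -a \<le> c \<and> c < d \<and> d \<le> a \<and> (\<forall>x\<in>{c..d}. \<rho>' x > 0)"
proof -
  have "\<exists>z. -a < z \<and> z < a \<and> \<rho> a - \<rho> (-a) = (a - (-a)) * \<rho>' z"
    by (rule MVT2) (use a rho_deriv in auto)
  then obtain z where z: "-a < z" "z < a" "\<rho> a - \<rho> (-a) = (a - (-a)) * \<rho>' z" by blast
  then have "\<rho>' z \<noteq> 0" using rho_ne rho_left[of "-a"] rho_right[of a] by auto
  then have zp: "\<rho>' z > 0" using rho'_nonneg[of z] by simp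
  have "open {x. \<rho>' x > 0}" by (intro open_Collect_less rho'_cont continuous_intros)
  with zp have "\<exists>d>0. \<forall>x. \<bar>x - z\<bar> < d \<longrightarrow> \<rho>' x > 0"
    by (auto simp: open_dist dist_real_def)
  then obtain d where d: "d > 0" "\<And>x. \<bar>x - z\<bar> < d \<Longrightarrow> \<rho>' x > 0" by blast
  show ?thesis
    by (rule exI[of _ z], rule exI[of _ "min a (z + d / 2)"]) (use z d in auto)
qed

text \<open>Monomials supply the directions. A combination of zero buoyancy would be a nonzero
  polynomial vanishing on an interval where \<open>\<rho>'\<close> is positive, which has infinitely
  many points.\<close>

lemma index_at_zero: "negative_definite (Q 0) n"
proof (cases n)
  case 0
  then show ?thesis by (simp add: negative_definite_def)
next
  case (Suc m)
  obtain c d where cd: "-a \<le> c" "c < d" "d \<le> a" "\<forall>x\<in>{c..d}. \<rho>' x > 0"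
    using rho'_pos_interval by blast
  have "\<exists>w. \<forall>x\<in>{-a..a}. d0 w x = x ^ i" for i
  proof -
    have "\<exists>w. \<forall>x\<in>{-a..a}. d0 w x = x ^ i \<and> d1 w x = real i * x ^ (i - 1)
        \<and> d2 w x = real i * (real (i - 1) * x ^ (i - 1 - 1))"
      by (rule C2_of_function) (auto intro!: derivative_eq_intros continuous_intros)
    then show ?thesis by blast
  qed
  then obtain u where u: "\<And>i x. x \<in> {-a..a} \<Longrightarrow> d0 (u i) x = x ^ i" by metis
  show ?thesis
    unfolding negative_definite_def
  proof (intro exI[of _ u] allI impI)
    fix b :: "nat \<Rightarrow> real"
    assume nz: "\<exists>i<n. b i \<noteq> 0"
    define w where "w = (\<Sum>i<n. b i *\<^sub>R u i)"
    have w: "d0 w x = (\<Sum>i\<le>m. b i * x ^ i)" if "x \<in> {-a..a}" for x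
      using that unfolding w_def d0_sum by (simp add: u Suc lessThan_Suc_atMost)
    have "buoyancy w w \<noteq> 0"
    proof
      assume "buoyancy w w = 0"
      then have "integral {-a..a} (\<lambda>x. \<rho>' x * d0 w x * d0 w x) = 0" by (simp add: buoyancy_def ip_def)
      then have z: "\<And>x. x \<in> {-a..a} \<Longrightarrow> \<rho>' x * d0 w x * d0 w x = 0"
        using a rho'_nonneg
        by (subst (asm) integral_eq_0_iff) (auto intro!: continuous_intros rho'_continuous simp: mult.assoc)
      have "{c..d} \<subseteq> {x. (\<Sum>i\<le>m. b i * x ^ i) = 0}"
      proof
        fix x assume x: "x \<in> {c..d}"
        then have "x \<in> {-a..a}" using cd by auto
        with z[OF this] bspec[OF cd(4) x] w[OF this] show "x \<in> {x. (\<Sum>i\<le>m. b i * x ^ i) = 0}" by auto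
      qed
      moreover have "finite {x. (\<Sum>i\<le>m. b i * x ^ i) = 0}"
        using nz Suc by (auto simp: less_Suc_eq_le intro: polyfun_roots_finite)
      ultimately have "finite {c..d}" by (rule finite_subset)
      with infinite_Icc[OF cd(2)] show False by simp
    qed
    then have "buoyancy w w > 0" using buoyancy_nonneg[of w] by simp
    then show "Q 0 (\<Sum>i<n. b i *\<^sub>R u i) (\<Sum>i<n. b i *\<^sub>R u i) < 0"
      using g k by (simp add: Q_def w_def[symmetric])
  qed
qed

section \<open>Compactness and dependence on the parameter\<close>

lemma sobolev_norm2_bounds:
  "0 \<le> sobolev_norm2 w" "energy0 w w \<le> sobolev_norm2 w" "energy1 w w \<le> sobolev_norm2 w" "energy2 w w \<le> sobolev_norm2 w"
  using energy_nonneg[of w] by (auto simp: sobolev_norm2_def)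

text \<open>The difference is a sum of scalars tending to 0 times quantities bounded through the
  Sobolev norm; the buoyancy carries no parameter and cancels.\<close>

lemma Q_perturbation:
  assumes s: "s \<longlonglongrightarrow> l" and B: "\<And>j. sobolev_norm2 (v j) \<le> B"
  shows "(\<lambda>j. Q l (v j) (v j) - Q (s j) (v j) (v j)) \<longlonglongrightarrow> 0"
proof -
  define E where "E = (\<lambda>j. energy2 (v j) (v j) + 2 * k\<^sup>2 * energy1 (v j) (v j) + k ^ 4 * energy0 (v j) (v j))"
  define J where "J = (\<lambda>j. ip \<rho> (d1 (v j)) (d1 (v j)) + k\<^sup>2 * ip \<rho> (d0 (v j)) (d0 (v j)))"
  define X where "X = (\<lambda>j. k * (d1 (v j) a)\<^sup>2 + k * (d1 (v j) (-a))\<^sup>2)"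
  define Y where "Y = (\<lambda>\<sigma> x j. (d1 (v j) x + \<sigma> * k * d0 (v j) x)\<^sup>2)"
  define Z where "Z = (\<lambda>x j. k * (d0 (v j) x)\<^sup>2)"
  have eb: "energy0 (v j) (v j) \<le> B" "energy1 (v j) (v j) \<le> B" "energy2 (v j) (v j) \<le> B" for j
    using sobolev_norm2_bounds[of "v j"] B[of j] by auto
  have B0: "B \<ge> 0" using sobolev_norm2_bounds(1)[of "v 0"] B[of 0] by linarith
  have Eb: "\<bar>E j\<bar> \<le> B + 2 * k\<^sup>2 * B + k ^ 4 * B" for j
  proof -
    have "E j \<ge> 0" unfolding E_def by (intro add_nonneg_nonneg mult_nonneg_nonneg energy_nonneg) auto
    moreover have "E j \<le> B + 2 * k\<^sup>2 * B + k ^ 4 * B"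
      unfolding E_def by (intro add_mono mult_left_mono eb) auto
    ultimately show ?thesis by simp
  qed
  obtain R where R: "R > 0" "\<forall>x\<in>{-a..a}. \<rho> x \<le> R" using rho_bounded by blast
  have Jb: "\<bar>J j\<bar> \<le> R * B + k\<^sup>2 * (R * B)" for j
  proof -
    have "J j \<ge> 0" unfolding J_def
      by (intro add_nonneg_nonneg mult_nonneg_nonneg ip_nonneg rho_continuous continuous_intros less_imp_le[OF rho_pos]) auto
    moreover have "J j \<le> R * energy1 (v j) (v j) + k\<^sup>2 * (R * energy0 (v j) (v j))"
      unfolding J_def by (intro add_mono mult_left_mono ip_mono rho_continuous continuous_intros) (use R in auto)
    moreover have "\<dots> \<le> R * B + k\<^sup>2 * (R * B)"
      using R by (intro add_mono mult_left_mono eb) auto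
    ultimately show ?thesis by simp
  qed
  define S where "S = (1 / a + 4 * a) * B"
  have sup: "(d0 (v j) x)\<^sup>2 \<le> S" "(d1 (v j) x)\<^sup>2 \<le> S" if "x \<in> {-a..a}" for j x
  proof -
    have "(1 / a + 4 * a) * sobolev_norm2 (v j) \<le> S"
      unfolding S_def using a by (intro mult_left_mono B) auto
    then show "(d0 (v j) x)\<^sup>2 \<le> S" "(d1 (v j) x)\<^sup>2 \<le> S" using d_sup[OF that, of "v j"] by auto
  qed
  have Xb: "\<bar>X j\<bar> \<le> k * S + k * S" for j
  proof -
    have "X j \<ge> 0" using k by (simp add: X_def)
    moreover have "X j \<le> k * S + k * S"
      unfolding X_def using k a by (intro add_mono mult_left_mono sup) auto
    ultimately show ?thesis by simp
  qed
  have Yb: "\<bar>Y \<sigma> x j\<bar> \<le> 2 * S + 2 * (k\<^sup>2 * S)" if "x \<in> {-a..a}" "\<sigma>\<^sup>2 = 1" for \<sigma> x j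
  proof -
    have "0 \<le> (d1 (v j) x - \<sigma> * k * d0 (v j) x)\<^sup>2" by simp
    then have "Y \<sigma> x j \<le> 2 * (d1 (v j) x)\<^sup>2 + 2 * (\<sigma> * k * d0 (v j) x)\<^sup>2"
      by (simp add: Y_def power2_sum power2_diff)
    also have "(\<sigma> * k * d0 (v j) x)\<^sup>2 = k\<^sup>2 * (d0 (v j) x)\<^sup>2" using that(2) by (simp add: power_mult_distrib)
    also have "2 * (d1 (v j) x)\<^sup>2 + 2 * (k\<^sup>2 * (d0 (v j) x)\<^sup>2) \<le> 2 * S + 2 * (k\<^sup>2 * S)"
      by (intro add_mono mult_left_mono sup that) auto
    finally show ?thesis by (simp add: Y_def)
  qed
  have Zb: "\<bar>Z x j\<bar> \<le> k * S" if "x \<in> {-a..a}" for x j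
    using sup(1)[OF that, of j] k by (simp add: Z_def abs_mult)
  \<comment> \<open>After \<open>bd_diag\<close> the parameter sits only in the scalars
    \<open>l\<close>, \<open>l^2\<close>, \<open>l * \<tau>\<close> and
    \<open>l * \<tau>^2\<close>.\<close>
  have Q: "Q l (v j) (v j) = l * (\<mu> * E j + \<mu> * X j) + l\<^sup>2 * J j - g * k\<^sup>2 * buoyancy (v j) (v j)
     + l * \<tau> l \<rho>\<^sub>p * (\<mu> * Y 1 a j) + l * (\<tau> l \<rho>\<^sub>p)\<^sup>2 * (\<mu> * Z a j)
     + l * \<tau> l \<rho>\<^sub>m * (\<mu> * Y (-1) (-a) j) + l * (\<tau> l \<rho>\<^sub>m)\<^sup>2 * (\<mu> * Z (-a) j)" for l j
    unfolding Q_def by (subst (1 2) bd_diag) (simp_all add: E_def J_def X_def Y_def Z_def algebra_simps)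
  have \<tau>s: "(\<lambda>j. \<tau> (s j) r) \<longlonglongrightarrow> \<tau> l r" for r
    unfolding \<tau>_def using \<mu> by (intro tendsto_intros s) auto
  have t: "(\<lambda>j. (L - c j) * (\<mu> * F j)) \<longlonglongrightarrow> 0" if "c \<longlonglongrightarrow> L" "\<And>j. \<bar>F j\<bar> \<le> M" for c L M and F :: "nat \<Rightarrow> real"
    using that \<mu> by (intro tendsto_coeff_mult_bounded[of _ _ _ "\<mu> * M"]) (auto simp: abs_mult)
  have "(\<lambda>j. (l - s j) * (\<mu> * E j) + (l - s j) * (\<mu> * X j) + (l\<^sup>2 - (s j)\<^sup>2) * J j
     + (l * \<tau> l \<rho>\<^sub>p - s j * \<tau> (s j) \<rho>\<^sub>p) * (\<mu> * Y 1 a j) + (l * (\<tau> l \<rho>\<^sub>p)\<^sup>2 - s j * (\<tau> (s j) \<rho>\<^sub>p)\<^sup>2) * (\<mu> * Z a j)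
     + (l * \<tau> l \<rho>\<^sub>m - s j * \<tau> (s j) \<rho>\<^sub>m) * (\<mu> * Y (-1) (-a) j) + (l * (\<tau> l \<rho>\<^sub>m)\<^sup>2 - s j * (\<tau> (s j) \<rho>\<^sub>m)\<^sup>2) * (\<mu> * Z (-a) j))
     \<longlonglongrightarrow> 0 + 0 + 0 + 0 + 0 + 0 + 0"
    using a by (intro tendsto_add t[OF _ Eb] t[OF _ Xb] tendsto_coeff_mult_bounded[OF _ Jb] t[OF _ Yb] t[OF _ Zb]
        tendsto_mult tendsto_power s \<tau>s) auto
  then show ?thesis unfolding Q by (simp add: algebra_simps)
qed

lemma ip_le_sup:
  assumes "continuous_on {-a..a} u" "\<And>x. x \<in> {-a..a} \<Longrightarrow> (u x)\<^sup>2 \<le> c"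
  shows "ip (\<lambda>_. 1) u u \<le> 2 * a * c"
proof -
  have "ip (\<lambda>_. 1) u u \<le> integral {-a..a} (\<lambda>x. c)"
    unfolding ip_def by (intro integral_le integrable_continuous_real continuous_intros assms)
      (use assms in \<open>auto simp: power2_eq_square\<close>)
  then show ?thesis using a by simp
qed

text \<open>Ties the buoyancy to the uniform size of \<open>d0\<close>, which is what compactness
  controls: uniform convergence makes the buoyancy of differences small and excludes a zero
  limit.\<close>

lemma buoyancy_le_sup:
  "\<exists>K>0. \<forall>w c. (\<forall>x\<in>{-a..a}. (d0 w x)\<^sup>2 \<le> c) \<longrightarrow> buoyancy w w \<le> K * c"
proof -
  obtain M where M: "M > 0" "\<forall>x\<in>{-a..a}. \<rho>' x \<le> M" using rho'_bounded by blast
  show ?thesis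
  proof (intro exI[of _ "M * (2 * a)"] conjI allI impI)
    show "M * (2 * a) > 0" using M a by simp
    fix w c assume c: "\<forall>x\<in>{-a..a}. (d0 w x)\<^sup>2 \<le> c"
    have "buoyancy w w \<le> M * energy0 w w"
      unfolding buoyancy_def by (intro ip_mono rho'_continuous continuous_intros) (use M in auto)
    also have "\<dots> \<le> M * (2 * a * c)"
      using M by (intro mult_left_mono ip_le_sup continuous_intros) (use c in auto)
    finally show "buoyancy w w \<le> M * (2 * a) * c" by (simp add: mult.assoc)
  qed
qed

text \<open>Rellich compactness by Arzela-Ascoli: \<open>d_sup\<close> bounds the functions,
  \<open>d0_holder\<close> makes them equicontinuous.\<close>

lemma uniformly_convergent_subsequence:
  assumes B: "\<And>j. sobolev_norm2 (v j) \<le> B"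
  obtains V r where "strict_mono (r :: nat \<Rightarrow> nat)" "uniform_limit {-a..a} (\<lambda>j. d0 (v (r j))) V sequentially"
proof -
  have B0: "B \<ge> 0" using sobolev_norm2_bounds(1)[of "v 0"] B[of 0] by linarith
  define S where "S = (1 / a + 4 * a) * B"
  have sup: "norm (d0 (v j) x) \<le> sqrt S" if "x \<in> {-a..a}" for j x
  proof -
    have "(1 / a + 4 * a) * sobolev_norm2 (v j) \<le> S"
      unfolding S_def using a by (intro mult_left_mono B) auto
    with d_sup(1)[OF that, of "v j"] have "(d0 (v j) x)\<^sup>2 \<le> S" by linarith
    then show ?thesis using real_le_rsqrt real_sqrt_le_mono by fastforce
  qed
  have eq: "\<exists>d. 0 < d \<and> (\<forall>n y. y \<in> {-a..a} \<and> norm (x - y) < d \<longrightarrow> norm (d0 (v n) x - d0 (v n) y) < e)"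
    if x: "x \<in> {-a..a}" and e: "0 < e" for x e
  proof (intro exI conjI allI impI)
    \<comment> \<open>With \<open>B + 1\<close> the final estimate is strict and
      \<open>B = 0\<close> is covered.\<close>
    show "0 < e\<^sup>2 / (B + 1)" using e B0 by simp
    fix n y assume y: "y \<in> {-a..a} \<and> norm (x - y) < e\<^sup>2 / (B + 1)"
    have "(d0 (v n) x - d0 (v n) y)\<^sup>2 \<le> \<bar>x - y\<bar> * energy1 (v n) (v n)"
      using d0_holder x y by blast
    also have "\<dots> \<le> \<bar>x - y\<bar> * B"
      using sobolev_norm2_bounds(3)[of "v n"] B[of n] by (intro mult_left_mono) auto
    also have "\<dots> \<le> e\<^sup>2 / (B + 1) * B" using y B0 by (intro mult_right_mono) auto
    also have "\<dots> < e\<^sup>2" using e B0 by (simp add: field_simps)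
    finally have "\<bar>d0 (v n) x - d0 (v n) y\<bar>\<^sup>2 < e\<^sup>2" by simp
    then show "norm (d0 (v n) x - d0 (v n) y) < e" using e by (simp add: power2_less_imp_less)
  qed
  obtain V r where Vr: "continuous_on {-a..a} V" "strict_mono (r :: nat \<Rightarrow> nat)"
    "\<And>e. 0 < e \<Longrightarrow> \<exists>N. \<forall>n x. n \<ge> N \<and> x \<in> {-a..a} \<longrightarrow> norm (d0 (v (r n)) x - V x) < e"
    using Arzela_Ascoli[of "{-a..a}" "\<lambda>j. d0 (v j)" "sqrt S", OF compact_Icc sup eq] by blast
  have "uniform_limit {-a..a} (\<lambda>j. d0 (v (r j))) V sequentially"
    unfolding uniform_limit_iff eventually_sequentially dist_norm using Vr(3) by blast
  with that Vr(2) show ?thesis by blast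
qed

text \<open>Divided by \<open>l\<close>, the equation reads
  \<open>\<mu> V'''' - (c1 V')' + c0 V = 0\<close>.\<close>

definition c0 :: "real \<Rightarrow> real \<Rightarrow> real" where
  "c0 l x = \<mu> * k ^ 4 + l * \<rho> x * k\<^sup>2 - g * k\<^sup>2 / l * \<rho>' x"

definition c1 :: "real \<Rightarrow> real \<Rightarrow> real" where
  "c1 l x = 2 * \<mu> * k\<^sup>2 + l * \<rho> x"

lemma c_continuous: "continuous_on S (c0 l)" "continuous_on S (c1 l)"
  unfolding c0_def c1_def by (intro continuous_intros rho_continuous rho'_continuous)+

text \<open>The coefficients are grouped with the fixed \<open>w\<close>, ready for uniform limits
  in \<open>v\<close>; the \<open>d2\<close> term, which has no uniform limit, stands apart.\<close>

lemma Q_normalized: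
  assumes "l \<noteq> 0"
  shows "Q l v w / l = integral {-a..a} (\<lambda>x. \<mu> * d2 v x * d2 w x)
    + (integral {-a..a} (\<lambda>x. (c1 l x * d1 w x) * d1 v x) + integral {-a..a} (\<lambda>x. (c0 l x * d0 w x) * d0 v x))
    + \<mu> * (bd (\<tau> l \<rho>\<^sub>p) 1 (d0 v a) (d1 v a) (d0 w a) (d1 w a)
              + bd (\<tau> l \<rho>\<^sub>m) (-1) (d0 v (-a)) (d1 v (-a)) (d0 w (-a)) (d1 w (-a)))"
proof -
  have i: "(\<lambda>x. p x * u x * w x) integrable_on {-a..a}"
    if "continuous_on {-a..a} p" "continuous_on {-a..a} u" "continuous_on {-a..a} w" for p u w :: "real \<Rightarrow> real"
    using that by (intro integrable_continuous_real continuous_intros)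
  have h: "((\<lambda>x. p x * u x * w x) has_integral ip p u w) {-a..a}"
    if "continuous_on {-a..a} p" "continuous_on {-a..a} u" "continuous_on {-a..a} w" for p u w :: "real \<Rightarrow> real"
    unfolding ip_def by (intro integrable_integral i that)
  note hs = h[OF continuous_on_const] h[OF rho_continuous] h[OF rho'_continuous]
  have A: "integral {-a..a} (\<lambda>x. \<mu> * d2 v x * d2 w x) = \<mu> * energy2 v w"
  proof (rule integral_unique)
    have "((\<lambda>x. \<mu> * (1 * d2 v x * d2 w x)) has_integral \<mu> * energy2 v w) {-a..a}"
      by (intro has_integral_mult_right hs continuous_intros)
    then show "((\<lambda>x. \<mu> * d2 v x * d2 w x) has_integral \<mu> * energy2 v w) {-a..a}" by (simp add: mult.assoc)
  qed
  have B: "integral {-a..a} (\<lambda>x. (c1 l x * d1 w x) * d1 v x) = 2 * \<mu> * k\<^sup>2 * energy1 v w + l * ip \<rho> (d1 v) (d1 w)"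
  proof (rule integral_unique)
    have "((\<lambda>x. 2 * \<mu> * k\<^sup>2 * (1 * d1 v x * d1 w x) + l * (\<rho> x * d1 v x * d1 w x)) has_integral
        2 * \<mu> * k\<^sup>2 * energy1 v w + l * ip \<rho> (d1 v) (d1 w)) {-a..a}"
      by (intro has_integral_add has_integral_mult_right hs continuous_intros)
    then show "((\<lambda>x. (c1 l x * d1 w x) * d1 v x) has_integral 2 * \<mu> * k\<^sup>2 * energy1 v w + l * ip \<rho> (d1 v) (d1 w)) {-a..a}"
      by (simp add: c1_def algebra_simps)
  qed
  have C: "integral {-a..a} (\<lambda>x. (c0 l x * d0 w x) * d0 v x)
      = \<mu> * k ^ 4 * energy0 v w + l * k\<^sup>2 * ip \<rho> (d0 v) (d0 w) - g * k\<^sup>2 / l * buoyancy v w"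
  proof (rule integral_unique)
    have "((\<lambda>x. \<mu> * k ^ 4 * (1 * d0 v x * d0 w x) + l * k\<^sup>2 * (\<rho> x * d0 v x * d0 w x)
         - g * k\<^sup>2 / l * (\<rho>' x * d0 v x * d0 w x)) has_integral
        \<mu> * k ^ 4 * energy0 v w + l * k\<^sup>2 * ip \<rho> (d0 v) (d0 w) - g * k\<^sup>2 / l * buoyancy v w) {-a..a}"
      unfolding buoyancy_def
      by (intro has_integral_add has_integral_diff has_integral_mult_right hs continuous_intros)
    then show "((\<lambda>x. (c0 l x * d0 w x) * d0 v x) has_integral
       \<mu> * k ^ 4 * energy0 v w + l * k\<^sup>2 * ip \<rho> (d0 v) (d0 w) - g * k\<^sup>2 / l * buoyancy v w) {-a..a}"
      by (simp add: c0_def algebra_simps)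
  qed
  show ?thesis unfolding A B C using assms unfolding Q_def by (simp add: field_simps power2_eq_square)
qed

section \<open>Kernel elements\<close>

text \<open>The unknowns \<open>G = - \<mu> V''\<close> and \<open>N = - G' - c1 V'\<close> turn the fourth-order equation into a
  first-order system; the conditions at \<open>\<plusminus>a\<close> say that \<open>V\<close> continues as a decaying exterior solution.\<close>

definition interior_mode :: "real \<Rightarrow> (real \<Rightarrow> real) \<Rightarrow> (real \<Rightarrow> real) \<Rightarrow> (real \<Rightarrow> real) \<Rightarrow> (real \<Rightarrow> real) \<Rightarrow> bool" where
  "interior_mode l V Y G N \<longleftrightarrow>
    (\<forall>x\<in>{-a..a}. (V has_real_derivative Y x) (at x within {-a..a}) \<and>
      (Y has_real_derivative - G x / \<mu>) (at x within {-a..a}) \<and>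
      (G has_real_derivative - (c1 l x * Y x + N x)) (at x within {-a..a}) \<and>
      (N has_real_derivative - (c0 l x * V x)) (at x within {-a..a})) \<and>
    G a = \<mu> * ((k + \<tau> l \<rho>\<^sub>p) * Y a + k * \<tau> l \<rho>\<^sub>p * V a) \<and>
    N a = \<mu> * (k * \<tau> l \<rho>\<^sub>p * Y a + k * \<tau> l \<rho>\<^sub>p * (k + \<tau> l \<rho>\<^sub>p) * V a) \<and>
    G (-a) = - \<mu> * ((k + \<tau> l \<rho>\<^sub>m) * Y (-a) - k * \<tau> l \<rho>\<^sub>m * V (-a)) \<and>
    N (-a) = - \<mu> * (- k * \<tau> l \<rho>\<^sub>m * Y (-a) + k * \<tau> l \<rho>\<^sub>m * (k + \<tau> l \<rho>\<^sub>m) * V (-a)) \<and>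
    (\<exists>x\<in>{-a..a}. V x \<noteq> 0)"

lemma C2_exists:
  assumes "continuous_on {-a..a} h"
  obtains w where "\<And>x. x \<in> {-a..a} \<Longrightarrow> d2 w x = h x"
proof -
  obtain b :: "real \<Rightarrow>\<^sub>C real" where "\<And>x. x \<in> cbox (-a) a \<Longrightarrow> b x = h x"
    using continuous_on_cbox_bcontfunE[of "-a" a h] assms by (metis cbox_interval)
  then show ?thesis by (intro that[of "(0, 0, b)"]) (simp add: d2_def cbox_interval)
qed

lemma antiderivative_from_integral:
  fixes F f :: "real \<Rightarrow> real"
  assumes f: "continuous_on {-a..a} f" and F: "\<And>x. x \<in> {-a..a} \<Longrightarrow> F x = C + c * integral {-a..x} f"
    and x: "x \<in> {-a..a}"
  shows "(F has_real_derivative c * f x) (at x within {-a..a})"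
proof -
  have "((\<lambda>x. C + c * integral {-a..x} f) has_real_derivative c * f x) (at x within {-a..a})"
    by (auto intro!: derivative_eq_intros integral_has_real_derivative f x)
  then show ?thesis by (rule has_field_derivative_transform_within[OF _ zero_less_one x]) (use F in auto)
qed

lemma d_ftc:
  assumes "x \<in> {-a..a}"
  shows "d0 w x = d0 w (-a) + integral {-a..x} (d1 w)" "d1 w x = d1 w (-a) + integral {-a..x} (d2 w)"
  by (simp_all add: d0_def d1_def)

text \<open>The second derivatives are Cauchy only in L2. \<open>N\<close> and \<open>G\<close> are
  therefore built from \<open>V\<close> and \<open>Y\<close> alone; testing identifies
  \<open>- G / \<mu>\<close> as the L2 limit of \<open>d2 (v j)\<close>, and the continuity of
  \<open>G\<close> then makes \<open>Y\<close> differentiable.\<close>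

lemma interior_mode_of_minimizing_sequence:
  assumes l: "l > 0" and W: "subspace W" and vW: "\<And>j. v j \<in> W"
    and Wpos: "\<And>w. w \<in> W \<Longrightarrow> Q l w w \<ge> 0"
    and CS: "\<And>w x. w \<in> W \<Longrightarrow> (Q l w x)\<^sup>2 \<le> Q l w w * C x"
    and Q0: "(\<lambda>j. Q l (v j) (v j)) \<longlonglongrightarrow> 0"
    and m: "\<And>j. buoyancy (v j) (v j) = 1"
    and uV: "uniform_limit {-a..a} (\<lambda>j. d0 (v j)) V sequentially"
  shows "\<exists>Y G N. interior_mode l V Y G N"
proof -
  note D = symmetric_formD[OF symmetric_Q[of l]]
  obtain K where K: "K > 0" "\<forall>w c. (\<forall>x\<in>{-a..a}. (d0 w x)\<^sup>2 \<le> c) \<longrightarrow> buoyancy w w \<le> K * c"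
    using buoyancy_le_sup by blast
  have bdiff: "\<exists>n. \<forall>i\<ge>n. \<forall>j\<ge>n. buoyancy (v i - v j) (v i - v j) \<le> e" if e: "e > 0" for e
  proof -
    have "sqrt (e / K) / 2 > 0" using e K by simp
    with uV obtain n where n: "\<forall>i\<ge>n. \<forall>x\<in>{-a..a}. dist (d0 (v i) x) (V x) < sqrt (e / K) / 2"
      unfolding uniform_limit_iff eventually_sequentially by blast
    have "buoyancy (v i - v j) (v i - v j) \<le> e" if ij: "i \<ge> n" "j \<ge> n" for i j
    proof -
      have "buoyancy (v i - v j) (v i - v j) \<le> K * (e / K)"
      proof (rule K(2)[rule_format])
        fix x assume x: "x \<in> {-a..a}"
        have "dist (d0 (v i) x) (d0 (v j) x) < sqrt (e / K)"
          using n ij x by (metis dist_triangle_half_l)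
        then have "\<bar>d0 (v i - v j) x\<bar> \<le> \<bar>sqrt (e / K)\<bar>" by (simp add: d_diff dist_real_def)
        then have "(d0 (v i - v j) x)\<^sup>2 \<le> (sqrt (e / K))\<^sup>2" by (simp only: abs_le_square_iff)
        then show "(d0 (v i - v j) x)\<^sup>2 \<le> e / K" using e K by simp
      qed
      then show ?thesis using K by simp
    qed
    then show ?thesis by blast
  qed
  have Qdiff: "Q l (v i - v j) (v i - v j) \<le> 2 * Q l (v i) (v i) + 2 * Q l (v j) (v j)" for i j
  proof -
    have "Q l (v i + v j) (v i + v j) \<ge> 0" by (intro Wpos subspace_add W vW)
    then show ?thesis by (simp add: D(2-5))
  qed
  have Cauchy: "\<exists>n. \<forall>i\<ge>n. \<forall>j\<ge>n. sobolev_norm2 (v i - v j) \<le> e" if e: "e > 0" for e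
  proof -
    \<comment> \<open>Coercivity turns \<open>e\<close> into \<open>e'\<close>: one half is spent on
      the buoyancy, the other on the four copies of \<open>e' / 8\<close> from
      \<open>Qdiff\<close>.\<close>
    define e' where "e' = l * coercivity * e"
    have e': "e' > 0" using e l coercivity_pos by (simp add: e'_def)
    have "e' / 2 / (g * k\<^sup>2) > 0" using e' g k by simp
    from bdiff[OF this] obtain n1 where n1: "\<And>i j. i \<ge> n1 \<Longrightarrow> j \<ge> n1 \<Longrightarrow> buoyancy (v i - v j) (v i - v j) \<le> e' / 2 / (g * k\<^sup>2)" by blast
    have "e' / 8 > 0" using e' by simp
    then obtain n2 where n2: "\<And>i. i \<ge> n2 \<Longrightarrow> \<bar>Q l (v i) (v i)\<bar> < e' / 8"
      using LIMSEQ_D[OF Q0] by (metis diff_zero real_norm_def)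
    have "sobolev_norm2 (v i - v j) \<le> e" if ij: "i \<ge> max n1 n2" "j \<ge> max n1 n2" for i j
    proof -
      have "l * coercivity * sobolev_norm2 (v i - v j) \<le> Q l (v i - v j) (v i - v j) + g * k\<^sup>2 * buoyancy (v i - v j) (v i - v j)"
        by (rule Q_coercive) (use l in simp)
      also have "g * k\<^sup>2 * buoyancy (v i - v j) (v i - v j) \<le> g * k\<^sup>2 * (e' / 2 / (g * k\<^sup>2))"
        using g ij by (intro mult_left_mono n1) auto
      also have "\<dots> = e' / 2" using g k by simp
      also have "Q l (v i - v j) (v i - v j) \<le> e' / 2"
        using Qdiff[of i j] n2[of i] n2[of j] ij by auto
      finally have "l * coercivity * sobolev_norm2 (v i - v j) \<le> e'" by simp
      then have "l * coercivity * sobolev_norm2 (v i - v j) \<le> l * coercivity * e" by (simp only: e'_def)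
      then show ?thesis using l coercivity_pos by simp
    qed
    then show ?thesis by blast
  qed
  have "uniformly_Cauchy_on {-a..a} (\<lambda>j. d1 (v j))"
  proof (rule uniformly_Cauchy_onI)
    fix e :: real assume e: "e > 0"
    define S where "S = 1 / a + 4 * a"
    have S: "S > 0" using a by (simp add: S_def add_pos_pos)
    have "(e / 2)\<^sup>2 / S > 0" using e S by simp
    from Cauchy[OF this] obtain n where n: "\<And>i j. i \<ge> n \<Longrightarrow> j \<ge> n \<Longrightarrow> sobolev_norm2 (v i - v j) \<le> (e / 2)\<^sup>2 / S" by blast
    have "dist (d1 (v i) x) (d1 (v j) x) < e" if x: "x \<in> {-a..a}" and ij: "i \<ge> n" "j \<ge> n" for i j x
    proof -
      have "(d1 (v i - v j) x)\<^sup>2 \<le> S * sobolev_norm2 (v i - v j)"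
        using d_sup(2)[OF x, of "v i - v j"] by (simp add: S_def)
      also have "\<dots> \<le> S * ((e / 2)\<^sup>2 / S)" using S by (intro mult_left_mono n ij) auto
      also have "\<dots> = (e / 2)\<^sup>2" using S by simp
      finally have "\<bar>d1 (v i - v j) x\<bar> \<le> \<bar>e / 2\<bar>" by (simp only: abs_le_square_iff)
      then show ?thesis using e by (simp add: d_diff dist_real_def)
    qed
    then show "\<exists>M. \<forall>x\<in>{-a..a}. \<forall>m\<ge>M. \<forall>n\<ge>M. dist (d1 (v m) x) (d1 (v n) x) < e" by blast
  qed
  then obtain Y where uY: "uniform_limit {-a..a} (\<lambda>j. d1 (v j)) Y sequentially"
    by (auto simp: uniformly_convergent_eq_Cauchy[symmetric] uniformly_convergent_on_def)
  have cV: "continuous_on {-a..a} V" and cY: "continuous_on {-a..a} Y"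
    by (rule uniform_limit_theorem[OF _ uV]; simp add: d0_continuous)
      (rule uniform_limit_theorem[OF _ uY]; simp add: d1_continuous)
  have pV: "(\<lambda>j. d0 (v j) x) \<longlonglongrightarrow> V x" and pY: "(\<lambda>j. d1 (v j) x) \<longlonglongrightarrow> Y x" if "x \<in> {-a..a}" for x
    using tendsto_uniform_limitI[OF uV that] tendsto_uniform_limitI[OF uY that] by auto
  have sub: "-a \<in> {-a..a}" "a \<in> {-a..a}" using a by auto
  have V': "(V has_real_derivative Y x) (at x within {-a..a})" if x: "x \<in> {-a..a}" for x
  proof -
    have "V x = V (-a) + 1 * integral {-a..x} Y" if x: "x \<in> {-a..a}" for x
    proof (rule LIMSEQ_unique[OF pV[OF x]])
      have "uniform_limit {-a..x} (\<lambda>j. d1 (v j)) Y sequentially"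
        using x by (intro uniform_limit_on_subset[OF uY]) auto
      then have "(\<lambda>j. d0 (v j) (-a) + integral {-a..x} (d1 (v j))) \<longlonglongrightarrow> V (-a) + integral {-a..x} Y"
        by (intro tendsto_add pV sub tendsto_integral_uniform d1_continuous)
      then show "(\<lambda>j. d0 (v j) x) \<longlonglongrightarrow> V (-a) + 1 * integral {-a..x} Y" using d_ftc(1)[OF x] by simp
    qed
    from antiderivative_from_integral[OF cY this x] show ?thesis by simp
  qed
  \<comment> \<open>\<open>N\<close> and \<open>G\<close> are integrated backwards from
    \<open>a\<close> with the exterior conditions as terminal values. The conditions at
    \<open>a\<close> hold by construction; those at \<open>-a\<close> remain to be derived.\<close>
  define N where "N = (\<lambda>x. \<mu> * (k * \<tau> l \<rho>\<^sub>p * Y a + k * \<tau> l \<rho>\<^sub>p * (k + \<tau> l \<rho>\<^sub>p) * V a) + integral {x..a} (\<lambda>t. c0 l t * V t))"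
  have cN': "continuous_on {-a..a} (\<lambda>t. c0 l t * V t)" by (intro continuous_intros c_continuous cV)
  have N': "(N has_real_derivative - (c0 l x * V x)) (at x within {-a..a})" if "x \<in> {-a..a}" for x
    unfolding N_def using integral_has_real_derivative'[OF cN' that] by (auto intro!: derivative_eq_intros)
  have cN: "continuous_on {-a..a} N" using N' by (rule DERIV_continuous_on)
  define G where "G = (\<lambda>x. \<mu> * ((k + \<tau> l \<rho>\<^sub>p) * Y a + k * \<tau> l \<rho>\<^sub>p * V a) + integral {x..a} (\<lambda>t. c1 l t * Y t + N t))"
  have cG': "continuous_on {-a..a} (\<lambda>t. c1 l t * Y t + N t)" by (intro continuous_intros c_continuous cY cN)
  have G': "(G has_real_derivative - (c1 l x * Y x + N x)) (at x within {-a..a})" if "x \<in> {-a..a}" for x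
    unfolding G_def using integral_has_real_derivative'[OF cG' that] by (auto intro!: derivative_eq_intros)
  have cG: "continuous_on {-a..a} G" using G' by (rule DERIV_continuous_on)
  have Ga: "G a = \<mu> * ((k + \<tau> l \<rho>\<^sub>p) * Y a + k * \<tau> l \<rho>\<^sub>p * V a)"
    and Na: "N a = \<mu> * (k * \<tau> l \<rho>\<^sub>p * Y a + k * \<tau> l \<rho>\<^sub>p * (k + \<tau> l \<rho>\<^sub>p) * V a)"
    by (simp_all add: G_def N_def)
  \<comment> \<open>\<open>LN\<close> and \<open>LG\<close> are the negatives of the values that the
    left exterior solution requires of \<open>N\<close> and \<open>G\<close> at
    \<open>-a\<close>.\<close>
  define LN where "LN = \<mu> * (- k * \<tau> l \<rho>\<^sub>m * Y (-a) + k * \<tau> l \<rho>\<^sub>m * (k + \<tau> l \<rho>\<^sub>m) * V (-a))"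
  define LG where "LG = \<mu> * ((k + \<tau> l \<rho>\<^sub>m) * Y (-a) - k * \<tau> l \<rho>\<^sub>m * V (-a))"
  \<comment> \<open>Integrates the derivative of \<open>N * d0 w + G * d1 w\<close>, moving
    everything onto \<open>d2 w\<close> and the endpoints.\<close>
  have parts: "integral {-a..a} (\<lambda>x. (c1 l x * d1 w x) * Y x) + integral {-a..a} (\<lambda>x. (c0 l x * d0 w x) * V x)
      = integral {-a..a} (\<lambda>x. G x * d2 w x) - (N a * d0 w a + G a * d1 w a) + (N (-a) * d0 w (-a) + G (-a) * d1 w (-a))" for w
  proof -
    have 1: "((\<lambda>x. G x * d2 w x - ((c1 l x * d1 w x) * Y x + (c0 l x * d0 w x) * V x)) has_integral
        (N a * d0 w a + G a * d1 w a) - (N (-a) * d0 w (-a) + G (-a) * d1 w (-a))) {-a..a}"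
    proof (rule fundamental_theorem_of_calculus)
      fix x assume x: "x \<in> {-a..a}"
      show "((\<lambda>x. N x * d0 w x + G x * d1 w x) has_vector_derivative
          G x * d2 w x - ((c1 l x * d1 w x) * Y x + (c0 l x * d0 w x) * V x)) (at x within {-a..a})"
        unfolding has_real_derivative_iff_has_vector_derivative[symmetric]
        by (rule derivative_eq_intros N'[OF x] G'[OF x] d0_deriv[OF x] d1_deriv[OF x] refl)+ (simp add: algebra_simps)
    qed (use a in simp)
    have 2: "((\<lambda>x. G x * d2 w x - ((c1 l x * d1 w x) * Y x + (c0 l x * d0 w x) * V x)) has_integral
        integral {-a..a} (\<lambda>x. G x * d2 w x) - (integral {-a..a} (\<lambda>x. (c1 l x * d1 w x) * Y x) + integral {-a..a} (\<lambda>x. (c0 l x * d0 w x) * V x))) {-a..a}"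
      by (intro has_integral_diff has_integral_add integrable_integral integrable_continuous_real continuous_intros c_continuous cV cY cG)
    from has_integral_unique[OF 2 1] show ?thesis by simp
  qed
  \<comment> \<open>\<open>CS\<close> makes \<open>Q l (v j) w\<close> tend to 0 for every
    \<open>w\<close>, in \<open>W\<close> or not. The terms at \<open>a\<close> cancel by the
    terminal values of \<open>N\<close> and \<open>G\<close>.\<close>
  have weak: "(\<lambda>j. integral {-a..a} (\<lambda>x. (\<mu> * d2 (v j) x + G x) * d2 w x)) \<longlonglongrightarrow>
      - ((N (-a) + LN) * d0 w (-a) + (G (-a) + LG) * d1 w (-a))" for w
  proof -
    have "(\<lambda>j. (Q l (v j) w)\<^sup>2) \<longlonglongrightarrow> 0"
    proof (rule tendsto_sandwich[OF _ _ tendsto_const])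
      show "(\<lambda>j. Q l (v j) (v j) * C w) \<longlonglongrightarrow> 0" using tendsto_mult_right[OF Q0, of "C w"] by simp
    qed (use CS vW in auto)
    then have "(\<lambda>j. Q l (v j) w) \<longlonglongrightarrow> 0" by (simp add: power_tendsto_0_iff)
    then have lim1: "(\<lambda>j. Q l (v j) w / l) \<longlonglongrightarrow> 0 / l" using l by (intro tendsto_divide) auto
    have lim2: "(\<lambda>j. integral {-a..a} (\<lambda>x. (c1 l x * d1 w x) * d1 (v j) x) + integral {-a..a} (\<lambda>x. (c0 l x * d0 w x) * d0 (v j) x)
      + \<mu> * (bd (\<tau> l \<rho>\<^sub>p) 1 (d0 (v j) a) (d1 (v j) a) (d0 w a) (d1 w a)
              + bd (\<tau> l \<rho>\<^sub>m) (-1) (d0 (v j) (-a)) (d1 (v j) (-a)) (d0 w (-a)) (d1 w (-a)))) \<longlonglongrightarrow>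
       integral {-a..a} (\<lambda>x. (c1 l x * d1 w x) * Y x) + integral {-a..a} (\<lambda>x. (c0 l x * d0 w x) * V x)
      + \<mu> * (bd (\<tau> l \<rho>\<^sub>p) 1 (V a) (Y a) (d0 w a) (d1 w a)
              + bd (\<tau> l \<rho>\<^sub>m) (-1) (V (-a)) (Y (-a)) (d0 w (-a)) (d1 w (-a)))"
      unfolding bd_def
      by (intro tendsto_intros pV pY sub tendsto_integral_uniform_mult uV uY continuous_intros c_continuous)
    have eq: "integral {-a..a} (\<lambda>x. \<mu> * d2 (v j) x * d2 w x) = Q l (v j) w / l -
       (integral {-a..a} (\<lambda>x. (c1 l x * d1 w x) * d1 (v j) x) + integral {-a..a} (\<lambda>x. (c0 l x * d0 w x) * d0 (v j) x)
      + \<mu> * (bd (\<tau> l \<rho>\<^sub>p) 1 (d0 (v j) a) (d1 (v j) a) (d0 w a) (d1 w a)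
              + bd (\<tau> l \<rho>\<^sub>m) (-1) (d0 (v j) (-a)) (d1 (v j) (-a)) (d0 w (-a)) (d1 w (-a))))" for j
      using Q_normalized[of l "v j" w] l by linarith
    have "(\<lambda>j. integral {-a..a} (\<lambda>x. \<mu> * d2 (v j) x * d2 w x)) \<longlonglongrightarrow> 0 / l -
        (integral {-a..a} (\<lambda>x. (c1 l x * d1 w x) * Y x) + integral {-a..a} (\<lambda>x. (c0 l x * d0 w x) * V x)
      + \<mu> * (bd (\<tau> l \<rho>\<^sub>p) 1 (V a) (Y a) (d0 w a) (d1 w a)
              + bd (\<tau> l \<rho>\<^sub>m) (-1) (V (-a)) (Y (-a)) (d0 w (-a)) (d1 w (-a))))"
      unfolding eq by (rule tendsto_diff[OF lim1 lim2])
    then have "(\<lambda>j. integral {-a..a} (\<lambda>x. \<mu> * d2 (v j) x * d2 w x) + integral {-a..a} (\<lambda>x. G x * d2 w x)) \<longlonglongrightarrow> 0 / l -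
        (integral {-a..a} (\<lambda>x. (c1 l x * d1 w x) * Y x) + integral {-a..a} (\<lambda>x. (c0 l x * d0 w x) * V x)
      + \<mu> * (bd (\<tau> l \<rho>\<^sub>p) 1 (V a) (Y a) (d0 w a) (d1 w a)
              + bd (\<tau> l \<rho>\<^sub>m) (-1) (V (-a)) (Y (-a)) (d0 w (-a)) (d1 w (-a)))) + integral {-a..a} (\<lambda>x. G x * d2 w x)"
      by (intro tendsto_add tendsto_const)
    also have "(\<lambda>j. integral {-a..a} (\<lambda>x. \<mu> * d2 (v j) x * d2 w x) + integral {-a..a} (\<lambda>x. G x * d2 w x))
      = (\<lambda>j. integral {-a..a} (\<lambda>x. (\<mu> * d2 (v j) x + G x) * d2 w x))"
      unfolding ring_distribs
      by (intro ext integral_add[symmetric] integrable_continuous_real continuous_intros cG)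
    finally show ?thesis unfolding parts Ga Na
      by (simp add: bd_def LN_def LG_def algebra_simps)
  qed
  \<comment> \<open>Testing with the constant 1 and, for \<open>GL\<close>, with
    \<open>x + a\<close>: their second derivatives vanish, and each isolates one term at
    \<open>-a\<close>.\<close>
  have NL: "N (-a) = - LN"
  proof -
    have d: "d2 (1, 0, 0) = (\<lambda>x. 0)" by (auto simp: d2_def zero_bcontfun.rep_eq)
    have "(\<lambda>j::nat. 0) \<longlonglongrightarrow> - (N (-a) + LN)" using weak[of "(1, 0, 0)"] by (simp add: d d1_def d0_def)
    from LIMSEQ_unique[OF this tendsto_const] show ?thesis by simp
  qed
  have GL: "G (-a) = - LG"
  proof -
    have d: "d2 (0, 1, 0) = (\<lambda>x. 0)" by (auto simp: d2_def zero_bcontfun.rep_eq)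
    have "(\<lambda>j::nat. 0) \<longlonglongrightarrow> - (G (-a) + LG)" using weak[of "(0, 1, 0)"] by (simp add: d d1_def d0_def)
    from LIMSEQ_unique[OF this tendsto_const] show ?thesis by simp
  qed
  define z where "z = (\<lambda>j x. \<mu> * d2 (v j) x + G x)"
  have cz: "continuous_on {-a..a} (z j)" for j unfolding z_def by (intro continuous_intros cG)
  \<comment> \<open>Every continuous function on the interval is the second derivative of some
    \<open>w\<close>; here \<open>z i\<close> itself is used.\<close>
  have zz: "(\<lambda>j. integral {-a..a} (\<lambda>x. z j x * z i x)) \<longlonglongrightarrow> 0" for i
  proof -
    obtain w where w: "\<And>x. x \<in> {-a..a} \<Longrightarrow> d2 w x = z i x" using C2_exists[OF cz] by blast
    have "integral {-a..a} (\<lambda>x. z j x * z i x) = integral {-a..a} (\<lambda>x. z j x * d2 w x)" for j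
      by (rule integral_cong) (simp add: w)
    with weak[of w] show ?thesis by (simp add: NL GL z_def)
  qed
  \<comment> \<open>Weak convergence and the Cauchy property give strong convergence:
    \<open>(z j)^2 \<le> (z j - z n)^2 + 2 * z j * z n\<close> with \<open>n\<close> fixed first,
    then \<open>j\<close> large.\<close>
  have zlim: "(\<lambda>j. integral {-a..a} (\<lambda>x. (z j x)\<^sup>2)) \<longlonglongrightarrow> 0"
  proof (rule LIMSEQ_I)
    fix e :: real assume e: "e > 0"
    have "e / 3 / \<mu>\<^sup>2 > 0" using e \<mu> by simp
    from Cauchy[OF this] obtain n where n: "\<And>i j. i \<ge> n \<Longrightarrow> j \<ge> n \<Longrightarrow> sobolev_norm2 (v i - v j) \<le> e / 3 / \<mu>\<^sup>2" by blast
    have "e / 3 > 0" using e by simp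
    then obtain n' where n': "\<And>j. j \<ge> n' \<Longrightarrow> \<bar>integral {-a..a} (\<lambda>x. z j x * z n x)\<bar> < e / 3"
      using LIMSEQ_D[OF zz[of n]] by (metis diff_zero real_norm_def)
    have "norm (integral {-a..a} (\<lambda>x. (z j x)\<^sup>2) - 0) < e" if j: "j \<ge> max n n'" for j
    proof -
      have "integral {-a..a} (\<lambda>x. (z j x)\<^sup>2) \<le> integral {-a..a} (\<lambda>x. \<mu>\<^sup>2 * (1 * d2 (v j - v n) x * d2 (v j - v n) x) + 2 * (z j x * z n x))"
      proof (rule integral_le)
        fix x
        have "z j x - z n x = \<mu> * d2 (v j - v n) x" by (simp add: z_def d_diff algebra_simps)
        then have "(z j x - z n x)\<^sup>2 = \<mu>\<^sup>2 * (1 * d2 (v j - v n) x * d2 (v j - v n) x)"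
          by (simp add: power2_eq_square algebra_simps)
        moreover have "(z j x)\<^sup>2 \<le> (z j x - z n x)\<^sup>2 + 2 * (z j x * z n x)" by (simp add: power2_diff)
        ultimately show "(z j x)\<^sup>2 \<le> \<mu>\<^sup>2 * (1 * d2 (v j - v n) x * d2 (v j - v n) x) + 2 * (z j x * z n x)" by simp
      qed (intro integrable_continuous_real continuous_intros cz)+
      also have "\<dots> = integral {-a..a} (\<lambda>x. \<mu>\<^sup>2 * (1 * d2 (v j - v n) x * d2 (v j - v n) x)) + integral {-a..a} (\<lambda>x. 2 * (z j x * z n x))"
        by (intro integral_add integrable_continuous_real continuous_intros cz)
      also have "\<dots> = \<mu>\<^sup>2 * energy2 (v j - v n) (v j - v n) + 2 * integral {-a..a} (\<lambda>x. z j x * z n x)"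
        unfolding integral_mult_right ip_def ..
      also have "\<mu>\<^sup>2 * energy2 (v j - v n) (v j - v n) \<le> \<mu>\<^sup>2 * (e / 3 / \<mu>\<^sup>2)"
        using sobolev_norm2_bounds(4)[of "v j - v n"] n[of j n] j by (intro mult_left_mono) auto
      also have "\<dots> = e / 3" using \<mu> by simp
      finally have "integral {-a..a} (\<lambda>x. (z j x)\<^sup>2) < e" using n'[of j] j by auto
      moreover have "integral {-a..a} (\<lambda>x. (z j x)\<^sup>2) \<ge> 0"
        by (intro integral_nonneg integrable_continuous_real continuous_intros cz) auto
      ultimately show ?thesis by simp
    qed
    then show "\<exists>no. \<forall>j\<ge>no. norm (integral {-a..a} (\<lambda>x. (z j x)\<^sup>2) - 0) < e" by blast
  qed
  have Y': "(Y has_real_derivative - G x / \<mu>) (at x within {-a..a})" if x: "x \<in> {-a..a}" for x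
  proof -
    have "Y x = Y (-a) + (- 1 / \<mu>) * integral {-a..x} G" if x: "x \<in> {-a..a}" for x
    proof -
      have sx: "{-a..x} \<subseteq> {-a..a}" using x by auto
      have "(\<lambda>j. (integral {-a..x} (z j))\<^sup>2) \<longlonglongrightarrow> 0"
      proof (rule tendsto_sandwich[OF _ _ tendsto_const])
        show "(\<lambda>j. 2 * a * integral {-a..a} (\<lambda>x. (z j x)\<^sup>2)) \<longlonglongrightarrow> 0" using tendsto_mult_left[OF zlim, of "2 * a"] by simp
        have "(integral {-a..x} (z j))\<^sup>2 \<le> 2 * a * integral {-a..a} (\<lambda>x. (z j x)\<^sup>2)" for j
        proof -
          have "(integral {-a..x} (\<lambda>t. 1 * z j t))\<^sup>2 \<le> integral {-a..x} (\<lambda>x. 1\<^sup>2) * integral {-a..x} (\<lambda>x. (z j x)\<^sup>2)"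
            by (intro integral_Cauchy_Schwarz continuous_intros continuous_on_subset[OF cz sx])
          also have "\<dots> \<le> 2 * a * integral {-a..a} (\<lambda>x. (z j x)\<^sup>2)"
            using x a by (intro mult_mono integral_subset_le sx integrable_continuous_real continuous_intros cz continuous_on_subset[OF cz sx]
                integral_nonneg) auto
          finally show ?thesis by simp
        qed
        then show "\<forall>\<^sub>F j in sequentially. (integral {-a..x} (z j))\<^sup>2 \<le> 2 * a * integral {-a..a} (\<lambda>x. (z j x)\<^sup>2)" by simp
      qed auto
      then have "(\<lambda>j. integral {-a..x} (z j)) \<longlonglongrightarrow> 0" by (simp add: power_tendsto_0_iff)
      moreover have "integral {-a..x} (z j) = \<mu> * (d1 (v j) x - d1 (v j) (-a)) + integral {-a..x} G" for j
      proof -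
        have "integral {-a..x} (z j) = integral {-a..x} (\<lambda>x. \<mu> * d2 (v j) x) + integral {-a..x} G"
          unfolding z_def by (intro integral_add integrable_continuous_real continuous_intros continuous_on_subset[OF cG sx])
        then show ?thesis using d_ftc(2)[OF x, of "v j"] by simp
      qed
      ultimately have "(\<lambda>j. \<mu> * (d1 (v j) x - d1 (v j) (-a)) + integral {-a..x} G) \<longlonglongrightarrow> 0" by simp
      moreover have "(\<lambda>j. \<mu> * (d1 (v j) x - d1 (v j) (-a)) + integral {-a..x} G) \<longlonglongrightarrow> \<mu> * (Y x - Y (-a)) + integral {-a..x} G"
        by (intro tendsto_intros pY x sub)
      ultimately have "\<mu> * (Y x - Y (-a)) + integral {-a..x} G = 0" using LIMSEQ_unique by blast
      then show ?thesis using \<mu> by (simp add: field_simps)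
    qed
    from antiderivative_from_integral[OF cG this x] show ?thesis by simp
  qed
  \<comment> \<open>If \<open>V\<close> were zero, uniform convergence would push the buoyancy down
    to 1/2, against its normalization to 1.\<close>
  have "\<exists>x\<in>{-a..a}. V x \<noteq> 0"
  proof (rule ccontr)
    assume V0: "\<not> ?thesis"
    have "sqrt (1 / (2 * K)) > 0" using K by simp
    with uV obtain j where j: "\<forall>x\<in>{-a..a}. dist (d0 (v j) x) (V x) < sqrt (1 / (2 * K))"
      unfolding uniform_limit_iff eventually_sequentially by blast
    have "buoyancy (v j) (v j) \<le> K * (1 / (2 * K))"
    proof (rule K(2)[rule_format])
      fix x assume x: "x \<in> {-a..a}"
      with j V0 have "\<bar>d0 (v j) x\<bar> \<le> \<bar>sqrt (1 / (2 * K))\<bar>" by (force simp: dist_real_def)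
      then have "(d0 (v j) x)\<^sup>2 \<le> (sqrt (1 / (2 * K)))\<^sup>2" by (simp only: abs_le_square_iff)
      then show "(d0 (v j) x)\<^sup>2 \<le> 1 / (2 * K)" using K by simp
    qed
    with m K show False by simp
  qed
  then have "interior_mode l V Y G N"
    unfolding interior_mode_def using V' Y' G' N' Ga Na NL GL by (simp add: LN_def LG_def)
  then show ?thesis by blast
qed

text \<open>Negativity of \<open>Q (s j)\<close> forces positive buoyancy, so the directions from
  \<open>index_jump\<close> can be normalized; the same negativity with coercivity then bounds their
  Sobolev norms.\<close>

lemma interior_mode_exists:
  assumes "\<epsilon> > 0"
  shows "\<exists>l V Y G N. 0 < l \<and> l \<le> \<epsilon> \<and> interior_mode l V Y G N"
proof -
  obtain n where n: "\<not> negative_definite (Q \<epsilon>) n" using finite_index[OF assms] by blast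
  obtain l s v W C where H: "0 < l" "l \<le> \<epsilon>" "s \<longlonglongrightarrow> l" "\<And>j::nat. 0 < s j \<and> s j \<le> \<epsilon>"
    "\<And>j. Q (s j) (v j) (v j) < 0" "\<And>j. v j \<in> W" "subspace W"
    "\<And>w. w \<in> W \<Longrightarrow> Q l w w \<ge> 0"
    "\<And>w x. w \<in> W \<Longrightarrow> (Q l w x)\<^sup>2 \<le> Q l w w * C x"
    using index_jump[of Q \<epsilon> n, OF symmetric_Q Q_continuous assms index_at_zero n] by blast
  have bpos: "buoyancy (v j) (v j) > 0" for j
  proof -
    have "0 \<le> s j * coercivity * sobolev_norm2 (v j)"
      using H(4)[of j] coercivity_pos sobolev_norm2_bounds(1)[of "v j"] by simp
    also have "\<dots> \<le> Q (s j) (v j) (v j) + g * k\<^sup>2 * buoyancy (v j) (v j)"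
      by (rule Q_coercive) (use H(4) less_imp_le in blast)
    finally have "g * k\<^sup>2 * buoyancy (v j) (v j) > 0" using H(5)[of j] by linarith
    moreover have "g * k\<^sup>2 > 0" using g k by simp
    ultimately show ?thesis by (rule zero_less_mult_pos)
  qed
  define u where "u = (\<lambda>j. (1 / sqrt (buoyancy (v j) (v j))) *\<^sub>R v j)"
  have um: "buoyancy (u j) (u j) = 1" for j
    using bpos[of j] by (simp add: u_def symmetric_formD[OF symmetric_buoyancy] field_simps)
  have uW: "u j \<in> W" for j unfolding u_def by (intro subspace_scale H)
  have uQ: "Q (s j) (u j) (u j) < 0" for j
    using bpos[of j] H(5)[of j] by (simp add: u_def symmetric_formD[OF symmetric_Q] divide_neg_pos)
  \<comment> \<open>The limit \<open>l\<close> is positive, so the reciprocals are bounded; this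
    offsets the factor \<open>s j\<close> in the coercivity.\<close>
  have "(\<lambda>j. inverse (s j)) \<longlonglongrightarrow> inverse l" using H by (intro tendsto_inverse) auto
  then have "Bseq (\<lambda>j. inverse (s j))" by (intro convergent_imp_Bseq convergentI)
  then obtain S where S: "S > 0" "\<And>j. norm (inverse (s j)) \<le> S" by (auto simp: Bseq_def)
  define B where "B = g * k\<^sup>2 / coercivity * S"
  have B: "sobolev_norm2 (u j) \<le> B" for j
  proof -
    have sj: "s j > 0" using H(4) by blast
    have "s j * coercivity * sobolev_norm2 (u j) \<le> Q (s j) (u j) (u j) + g * k\<^sup>2 * buoyancy (u j) (u j)"
      by (rule Q_coercive) (use sj in simp)
    also have "\<dots> \<le> g * k\<^sup>2" using uQ[of j] um by simp
    finally have "sobolev_norm2 (u j) \<le> g * k\<^sup>2 / coercivity * inverse (s j)"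
      using sj coercivity_pos by (simp add: field_simps)
    also have "\<dots> \<le> B" unfolding B_def
      using S(2)[of j] sj g k coercivity_pos by (intro mult_left_mono) auto
    finally show ?thesis .
  qed
  \<comment> \<open>Squeezed between 0, by positivity on \<open>W\<close>, and the perturbation
    difference, since \<open>Q (s j)\<close> is negative on \<open>u j\<close>.\<close>
  have Q0: "(\<lambda>j. Q l (u j) (u j)) \<longlonglongrightarrow> 0"
  proof (rule tendsto_sandwich[OF _ _ tendsto_const Q_perturbation[OF H(3) B]])
    show "\<forall>\<^sub>F j in sequentially. 0 \<le> Q l (u j) (u j)" using H(8) uW by simp
    show "\<forall>\<^sub>F j in sequentially. Q l (u j) (u j) \<le> Q l (u j) (u j) - Q (s j) (u j) (u j)"
      using less_imp_le[OF uQ] by simp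
  qed
  obtain V r where r: "strict_mono (r :: nat \<Rightarrow> nat)" "uniform_limit {-a..a} (\<lambda>j. d0 (u (r j))) V sequentially"
    using uniformly_convergent_subsequence[of u B, OF B] by blast
  have "\<exists>Y G N. interior_mode l V Y G N"
  proof (rule interior_mode_of_minimizing_sequence[where v = "\<lambda>j. u (r j)", OF H(1,7) uW H(8,9) _ um r(2)])
    show "(\<lambda>j. Q l (u (r j)) (u (r j))) \<longlonglongrightarrow> 0" using LIMSEQ_subseq_LIMSEQ[OF Q0 r(1)] by (simp add: o_def)
  qed
  with H show ?thesis by blast
qed

end

section \<open>Matching with the exterior solutions\<close>

text \<open>\<open>n\<close> counts derivatives, so one family holds all of them; centering at
  \<open>c\<close> makes the values at the matching point algebraic.\<close>

definition exp_pair :: "real \<Rightarrow> real \<Rightarrow> real \<Rightarrow> real \<Rightarrow> real \<Rightarrow> nat \<Rightarrow> real \<Rightarrow> real" where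
  "exp_pair \<kappa> \<theta> A B c n x = A * \<kappa> ^ n * exp (\<kappa> * (x - c)) + B * \<theta> ^ n * exp (\<theta> * (x - c))"

lemma exp_pair_deriv: "(exp_pair \<kappa> \<theta> A B c n has_real_derivative exp_pair \<kappa> \<theta> A B c (Suc n) x) (at x)"
  unfolding exp_pair_def by (auto intro!: derivative_eq_intros simp: algebra_simps)

text \<open>The characteristic polynomial has the roots \<open>\<kappa>\<close> and
  \<open>\<theta>\<close>. At the matching point this expresses orders 2 and 3 through orders 0 and
  1.\<close>

lemma exp_pair_recurrence:
  "exp_pair \<kappa> \<theta> A B c (Suc (Suc n)) x
    = (\<kappa> + \<theta>) * exp_pair \<kappa> \<theta> A B c (Suc n) x - \<kappa> * \<theta> * exp_pair \<kappa> \<theta> A B c n x"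
  unfolding exp_pair_def by (simp add: algebra_simps)

lemma exp_pair_initial_values:
  assumes "\<theta> \<noteq> \<kappa>"
  shows "\<exists>A B. exp_pair \<kappa> \<theta> A B c 0 c = v \<and> exp_pair \<kappa> \<theta> A B c (Suc 0) c = w"
proof -
  define B where "B = (w - \<kappa> * v) / (\<theta> - \<kappa>)"
  have "(v - B) * \<kappa> + B * \<theta> = \<kappa> * v + B * (\<theta> - \<kappa>)" by (simp add: algebra_simps)
  also have "\<dots> = w" using assms by (simp add: B_def)
  finally show ?thesis by (intro exI[of _ "v - B"] exI[of _ B]) (simp add: exp_pair_def)
qed

text \<open>The equation is \<open>(D^2 - \<kappa>^2) (D^2 - \<kappa>^2 - r) u = 0\<close>, and each
  exponential is annihilated by one factor.\<close>

lemma exp_pair_ode: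
  assumes "\<theta>\<^sup>2 = \<kappa>\<^sup>2 + r"
  shows "exp_pair \<kappa> \<theta> A B c 4 x - 2 * \<kappa>\<^sup>2 * exp_pair \<kappa> \<theta> A B c 2 x + \<kappa> ^ 4 * exp_pair \<kappa> \<theta> A B c 0 x
    = r * (exp_pair \<kappa> \<theta> A B c 2 x - \<kappa>\<^sup>2 * exp_pair \<kappa> \<theta> A B c 0 x)"
proof -
  have r: "r = \<theta>\<^sup>2 - \<kappa>\<^sup>2" using assms by simp
  show ?thesis unfolding r exp_pair_def
    by (simp add: power2_eq_square power4_eq_xxxx algebra_simps)
qed

text \<open>The sign conditions cover both half lines, with positive exponents to the left of
  \<open>c\<close> and negative ones to the right; the slower rate \<open>\<kappa>\<close> controls
  both terms.\<close>

lemma exp_pair_decay: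
  assumes "\<kappa> * \<theta> > 0" "\<bar>\<theta>\<bar> \<ge> \<bar>\<kappa>\<bar>" "\<kappa> * (x - c) \<le> 0"
  shows "\<bar>exp_pair \<kappa> \<theta> A B c n x\<bar> \<le> (\<bar>A * \<kappa> ^ n\<bar> + \<bar>B * \<theta> ^ n\<bar>) * exp (- \<bar>\<kappa>\<bar> * \<bar>x - c\<bar>)"
proof -
  have e1: "\<kappa> * (x - c) = - \<bar>\<kappa>\<bar> * \<bar>x - c\<bar>" using assms(3) by (simp add: abs_mult[symmetric])
  have "\<theta> * (x - c) \<le> 0" using assms(1,3)
    by (auto simp: zero_less_mult_iff mult_le_0_iff)
  then have "\<theta> * (x - c) = - \<bar>\<theta>\<bar> * \<bar>x - c\<bar>" by (simp add: abs_mult[symmetric])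
  also have "\<dots> \<le> - \<bar>\<kappa>\<bar> * \<bar>x - c\<bar>" using assms(2) by (simp add: mult_right_mono)
  finally have e2: "exp (\<theta> * (x - c)) \<le> exp (- \<bar>\<kappa>\<bar> * \<bar>x - c\<bar>)" by simp
  have "\<bar>exp_pair \<kappa> \<theta> A B c n x\<bar> \<le> \<bar>A * \<kappa> ^ n\<bar> * exp (\<kappa> * (x - c)) + \<bar>B * \<theta> ^ n\<bar> * exp (\<theta> * (x - c))"
    unfolding exp_pair_def by (rule order_trans[OF abs_triangle_ineq]) (simp add: abs_mult)
  also have "\<dots> \<le> \<bar>A * \<kappa> ^ n\<bar> * exp (- \<bar>\<kappa>\<bar> * \<bar>x - c\<bar>) + \<bar>B * \<theta> ^ n\<bar> * exp (- \<bar>\<kappa>\<bar> * \<bar>x - c\<bar>)"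
    unfolding e1 by (intro add_mono mult_left_mono e2) auto
  finally show ?thesis by (simp only: ring_distribs)
qed

context rayleigh_taylor
begin

section \<open>Gluing the interior solution to the half lines\<close>

lemma rho_mono: "x \<le> y \<Longrightarrow> \<rho> x \<le> \<rho> y"
  by (rule DERIV_nonneg_imp_nondecreasing) (use rho_deriv rho'_nonneg in auto)

text \<open>By monotonicity the plateau value is the maximum of the density, so the derivative
  vanishes on the plateau including \<open>a\<close> itself, where the fourth derivatives are
  matched.\<close>

lemma rho'_right: assumes "x \<ge> a" shows "\<rho>' x = 0"
proof (rule DERIV_local_max[OF rho_deriv zero_less_one], intro allI impI)
  fix y
  have "\<rho> y \<le> \<rho> (max x y)" by (rule rho_mono) simp
  then show "\<rho> y \<le> \<rho> x" using rho_right[of x] rho_right[of "max x y"] assms by (simp add: max_def split: if_splits)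
qed

lemma rho'_left: assumes "x \<le> -a" shows "\<rho>' x = 0"
proof (rule DERIV_local_min[OF rho_deriv zero_less_one], intro allI impI)
  fix y
  have "\<rho> (min x y) \<le> \<rho> y" by (rule rho_mono) simp
  then show "\<rho> x \<le> \<rho> y" using rho_left[of x] rho_left[of "min x y"] assms by (simp add: min_def split: if_splits)
qed

text \<open>The two amplitudes on each half line match orders 0 and 1 at the endpoint. The
  conditions on \<open>G\<close> and \<open>N\<close> are exactly the matching of orders 2 and 3,
  and the equation then matches order 4.\<close>

lemma classical_mode_exists:
  assumes mode: "interior_mode l V Y G N" and l: "l > 0"
  shows "\<exists>\<Phi>. (\<forall>i<4. \<forall>x. (\<Phi> i has_real_derivative \<Phi> (Suc i) x) (at x)) \<and>
    (\<forall>x. \<Phi> 4 x = 2 * k\<^sup>2 * \<Phi> 2 x - k ^ 4 * \<Phi> 0 x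
        + l / \<mu> * (\<rho>' x * \<Phi> 1 x + \<rho> x * \<Phi> 2 x - \<rho> x * k\<^sup>2 * \<Phi> 0 x) + g * k\<^sup>2 / (l * \<mu>) * \<rho>' x * \<Phi> 0 x) \<and>
    (\<forall>i\<le>4. \<exists>A. \<forall>x. \<bar>x\<bar> > a \<longrightarrow> \<bar>\<Phi> i x\<bar> \<le> A * exp (- k * \<bar>x\<bar>)) \<and>
    (\<exists>x. \<Phi> (0::nat) x \<noteq> 0)"
proof -
  define \<tau>p \<tau>m where "\<tau>p = \<tau> l \<rho>\<^sub>p" and "\<tau>m = \<tau> l \<rho>\<^sub>m"
  have \<tau>2: "\<tau>p\<^sup>2 = k\<^sup>2 + l * \<rho>\<^sub>p / \<mu>" "\<tau>m\<^sup>2 = k\<^sup>2 + l * \<rho>\<^sub>m / \<mu>"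
    using l \<mu> rho_const_pos by (simp_all add: \<tau>p_def \<tau>m_def \<tau>_def add_nonneg_nonneg)
  have \<tau>k: "\<tau>p > k" "\<tau>m > k"
  proof -
    have "k\<^sup>2 < \<tau>p\<^sup>2" "k\<^sup>2 < \<tau>m\<^sup>2" unfolding \<tau>2 using l \<mu> rho_const_pos by simp_all
    moreover have "\<tau>p \<ge> 0" "\<tau>m \<ge> 0"
      using \<tau>_pos[of l] rho_const_pos l by (auto simp: \<tau>p_def \<tau>m_def less_imp_le)
    ultimately show "\<tau>p > k" "\<tau>m > k" by (auto intro: power2_less_imp_less)
  qed
  have mode': "\<And>x. x \<in> {-a..a} \<Longrightarrow> (V has_real_derivative Y x) (at x within {-a..a})"
      "\<And>x. x \<in> {-a..a} \<Longrightarrow> (Y has_real_derivative - G x / \<mu>) (at x within {-a..a})"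
      "\<And>x. x \<in> {-a..a} \<Longrightarrow> (G has_real_derivative - (c1 l x * Y x + N x)) (at x within {-a..a})"
      "\<And>x. x \<in> {-a..a} \<Longrightarrow> (N has_real_derivative - (c0 l x * V x)) (at x within {-a..a})"
      "G a = \<mu> * ((k + \<tau>p) * Y a + k * \<tau>p * V a)"
      "N a = \<mu> * (k * \<tau>p * Y a + k * \<tau>p * (k + \<tau>p) * V a)"
      "G (-a) = - \<mu> * ((k + \<tau>m) * Y (-a) - k * \<tau>m * V (-a))"
      "N (-a) = - \<mu> * (- k * \<tau>m * Y (-a) + k * \<tau>m * (k + \<tau>m) * V (-a))"
      "\<exists>x\<in>{-a..a}. V x \<noteq> 0"
    using mode unfolding interior_mode_def \<tau>p_def \<tau>m_def by blast+
  obtain A B where AB: "exp_pair k \<tau>m A B (-a) 0 (-a) = V (-a)" "exp_pair k \<tau>m A B (-a) (Suc 0) (-a) = Y (-a)"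
    using exp_pair_initial_values[of \<tau>m k] \<tau>k by blast
  obtain A' B' where AB': "exp_pair (-k) (-\<tau>p) A' B' a 0 a = V a" "exp_pair (-k) (-\<tau>p) A' B' a (Suc 0) a = Y a"
  proof -
    have "- \<tau>p \<noteq> - k" using \<tau>k by simp
    from exp_pair_initial_values[OF this] show ?thesis using that by blast
  qed
  define L where "L = exp_pair k \<tau>m A B (-a)"
  define R where "R = exp_pair (-k) (-\<tau>p) A' B' a"
  define rhs where "rhs = (\<lambda>x u0 u1 u2. 2 * k\<^sup>2 * u2 - k ^ 4 * u0
        + l / \<mu> * (\<rho>' x * u1 + \<rho> x * u2 - \<rho> x * k\<^sup>2 * u0) + g * k\<^sup>2 / (l * \<mu>) * \<rho>' x * u0)"
  define M where "M = (\<lambda>i::nat. if i = 0 then V else if i = 1 then Y else if i = 2 then (\<lambda>x. - G x / \<mu>)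
     else if i = 3 then (\<lambda>x. (c1 l x * Y x + N x) / \<mu>) else (\<lambda>x. rhs x (V x) (Y x) (- G x / \<mu>)))"
  define \<Phi> where "\<Phi> = (\<lambda>i x. if x < -a then L i x else if x \<le> a then M i x else R i x)"
  have L01: "L 0 (-a) = V (-a)" "L (Suc 0) (-a) = Y (-a)"
    using AB by (simp_all add: L_def)
  have R01: "R 0 a = V a" "R (Suc 0) a = Y a"
    using AB' by (simp_all add: R_def)
  have Lrec: "L (Suc (Suc n)) x = (k + \<tau>m) * L (Suc n) x - k * \<tau>m * L n x" for n x
    unfolding L_def by (rule exp_pair_recurrence)
  have Rrec: "R (Suc (Suc n)) x = - (k + \<tau>p) * R (Suc n) x - k * \<tau>p * R n x" for n x
    unfolding R_def by (subst exp_pair_recurrence) simp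
  have Lode: "L 4 x = rhs x (L 0 x) (L 1 x) (L 2 x)" if "x \<le> -a" for x
    using exp_pair_ode[OF \<tau>2(2), of A B "-a" x] rho_left[OF that] rho'_left[OF that] \<mu>
    by (simp add: L_def rhs_def field_simps)
  have Rode: "R 4 x = rhs x (R 0 x) (R 1 x) (R 2 x)" if "x \<ge> a" for x
  proof -
    have "(- \<tau>p)\<^sup>2 = (- k)\<^sup>2 + l * \<rho>\<^sub>p / \<mu>" using \<tau>2 by simp
    from exp_pair_ode[OF this, of A' B' a x] show ?thesis
      using rho_right[OF that] rho'_right[OF that] \<mu> by (simp add: R_def rhs_def field_simps)
  qed
  have n: "(2::nat) = Suc (Suc 0)" "(3::nat) = Suc (Suc (Suc 0))" by simp_all
  have mL: "L i (-a) = M i (-a)" if "i \<le> 4" for i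
  proof -
    have 2: "L 2 (-a) = - G (-a) / \<mu>" unfolding n Lrec L01 mode'(7) using \<mu> by simp
    have 3: "L 3 (-a) = (c1 l (-a) * Y (-a) + N (-a)) / \<mu>"
    proof -
      \<comment> \<open>This plateau value of \<open>c1\<close> turns the condition on
        \<open>N\<close> into the equality of third derivatives given by the recurrence.\<close>
      have "c1 l (-a) = \<mu> * (k\<^sup>2 + \<tau>m\<^sup>2)" using rho_left[of "-a"] \<mu> by (simp add: \<tau>2 c1_def field_simps)
      then show ?thesis unfolding n Lrec L01 mode'(8) using \<mu> by (simp add: field_simps power2_eq_square)
    qed
    have 4: "L 4 (-a) = M 4 (-a)"
      using Lode[of "-a"] 2 L01 by (simp add: M_def)
    have "i = 0 \<or> i = 1 \<or> i = 2 \<or> i = 3 \<or> i = 4" using that by presburger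
    then show ?thesis using 2 3 4 L01 by (elim disjE) (simp_all add: M_def)
  qed
  have mR: "R i a = M i a" if "i \<le> 4" for i
  proof -
    have 2: "R 2 a = - G a / \<mu>" unfolding n Rrec R01 mode'(5) using \<mu> by (simp add: field_simps)
    have 3: "R 3 a = (c1 l a * Y a + N a) / \<mu>"
    proof -
      have "c1 l a = \<mu> * (k\<^sup>2 + \<tau>p\<^sup>2)" using rho_right[of a] \<mu> by (simp add: \<tau>2 c1_def field_simps)
      then show ?thesis unfolding n Rrec R01 mode'(6) using \<mu> by (simp add: field_simps power2_eq_square)
    qed
    have 4: "R 4 a = M 4 a"
      using Rode[of a] 2 R01 by (simp add: M_def)
    have "i = 0 \<or> i = 1 \<or> i = 2 \<or> i = 3 \<or> i = 4" using that by presburger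
    then show ?thesis using 2 3 4 R01 by (elim disjE) (simp_all add: M_def)
  qed
  have dM: "(M i has_real_derivative M (Suc i) x) (at x within {-a..a})" if i: "i < 4" and x: "x \<in> {-a..a}" for i x
  proof -
    have "((\<lambda>x. - G x / \<mu>) has_real_derivative (c1 l x * Y x + N x) / \<mu>) (at x within {-a..a})"
      using \<mu> by (auto intro!: derivative_eq_intros mode'(3)[OF x] simp: field_simps)
    moreover have "((\<lambda>x. (c1 l x * Y x + N x) / \<mu>) has_real_derivative rhs x (V x) (Y x) (- G x / \<mu>)) (at x within {-a..a})"
      unfolding c1_def using \<mu> l
      by (auto intro!: derivative_eq_intros mode'(2)[OF x] mode'(4)[OF x] DERIV_subset[OF rho_deriv]
        simp: rhs_def c0_def field_simps)
    moreover have "i = 0 \<or> i = 1 \<or> i = 2 \<or> i = 3" using i by presburger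
    ultimately show ?thesis
      using mode'(1)[OF x] mode'(2)[OF x] by (elim disjE) (simp_all add: M_def)
  qed
  have deriv: "(\<Phi> i has_real_derivative \<Phi> (Suc i) x) (at x)" if i: "i < 4" for i x
    unfolding \<Phi>_def
  proof (rule has_real_derivative_glue)
    show "(L i has_real_derivative L (Suc i) x) (at x)" "(R i has_real_derivative R (Suc i) x) (at x)" for x
      unfolding L_def R_def by (rule exp_pair_deriv)+
    show "(M i has_real_derivative M (Suc i) x) (at x within {-a..a})" if "x \<in> {-a..a}" for x
      by (rule dM[OF i that])
    show "L i (-a) = M i (-a)" "L (Suc i) (-a) = M (Suc i) (-a)" "R i a = M i a" "R (Suc i) a = M (Suc i) a"
      using i by (simp_all add: mL mR)
  qed (use a in simp)
  have ode: "\<Phi> 4 x = rhs x (\<Phi> 0 x) (\<Phi> 1 x) (\<Phi> 2 x)" for x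
    using Lode[of x] Rode[of x] by (auto simp: \<Phi>_def M_def)
  have decay: "\<exists>A. \<forall>x. \<bar>x\<bar> > a \<longrightarrow> \<bar>\<Phi> i x\<bar> \<le> A * exp (- k * \<bar>x\<bar>)" for i
  proof -
    have "k * \<tau>m > 0" "k * \<tau>p > 0" using k \<tau>k by (auto intro: mult_pos_pos)
    define A1 where "A1 = \<bar>A * k ^ i\<bar> + \<bar>B * \<tau>m ^ i\<bar>"
    have A1: "\<bar>L i x\<bar> \<le> A1 * exp (- \<bar>k\<bar> * \<bar>x - (-a)\<bar>)" if "x < -a" for x
      unfolding L_def A1_def
    proof (rule exp_pair_decay)
      show "k * (x - (-a)) \<le> 0" using k that by (intro mult_nonneg_nonpos) auto
    qed (use \<open>k * \<tau>m > 0\<close> \<tau>k k in auto)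
    define A2 where "A2 = \<bar>A' * (-k) ^ i\<bar> + \<bar>B' * (-\<tau>p) ^ i\<bar>"
    have A2: "\<bar>R i x\<bar> \<le> A2 * exp (- \<bar>-k\<bar> * \<bar>x - a\<bar>)" if "x > a" for x
      unfolding R_def A2_def
    proof (rule exp_pair_decay)
      show "- k * (x - a) \<le> 0" using k that by (intro mult_nonpos_nonneg) auto
    qed (use \<open>k * \<tau>p > 0\<close> \<tau>k k in auto)
    \<comment> \<open>The factor \<open>exp (k * a)\<close> converts decay in the distance to the
      interval into decay in the modulus of \<open>x\<close>.\<close>
    have "\<bar>\<Phi> i x\<bar> \<le> (max A1 A2 * exp (k * a)) * exp (- k * \<bar>x\<bar>)" if x: "\<bar>x\<bar> > a" for x
    proof -
      have e: "exp (k * a) * exp (- k * \<bar>x\<bar>) = exp (- k * (\<bar>x\<bar> - a))"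
        by (simp add: exp_add[symmetric] algebra_simps)
      show ?thesis
      proof (cases "x < 0")
        case True
        then have "x < -a" using x by simp
        then have "\<bar>\<Phi> i x\<bar> \<le> A1 * exp (- k * (\<bar>x\<bar> - a))" using A1[of x] True k by (simp add: \<Phi>_def algebra_simps)
        also have "\<dots> \<le> max A1 A2 * exp (- k * (\<bar>x\<bar> - a))" by (intro mult_right_mono) auto
        finally show ?thesis by (simp only: e mult.assoc)
      next
        case False
        then have "x > a" using x by simp
        then have "\<bar>\<Phi> i x\<bar> \<le> A2 * exp (- k * (\<bar>x\<bar> - a))" using A2[of x] False k a by (simp add: \<Phi>_def algebra_simps)
        also have "\<dots> \<le> max A1 A2 * exp (- k * (\<bar>x\<bar> - a))" by (intro mult_right_mono) auto
        finally show ?thesis by (simp only: e mult.assoc)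
      qed
    qed
    then show ?thesis by blast
  qed
  have nonzero: "\<exists>x. \<Phi> 0 x \<noteq> 0"
  proof -
    obtain x where "x \<in> {-a..a}" "V x \<noteq> 0" using mode'(9) by blast
    then show ?thesis by (intro exI[of _ x]) (simp add: \<Phi>_def M_def)
  qed
  show ?thesis
    by (intro exI[of _ \<Phi>] conjI) (use deriv ode[unfolded rhs_def] decay nonzero in blast)+
qed

text \<open>Packages the claim for one index, so that the sequence can be chosen by rate alone and
  the functions picked afterwards.\<close>

definition growing_mode :: "real \<Rightarrow> (real \<Rightarrow> real) \<Rightarrow> bool" where
  "growing_mode l \<phi> \<longleftrightarrow> \<phi> \<in> sobolev_H 4 \<and> \<not> (AE x in lebesgue. \<phi> x = 0) \<and>
     (\<exists>\<phi>' \<phi>'' \<phi>4 q. weak_deriv 1 \<phi> \<phi>' \<and> weak_deriv 2 \<phi> \<phi>'' \<and> weak_deriv 4 \<phi> \<phi>4 \<and>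
        weak_deriv 1 (\<lambda>x. \<rho> x * \<phi>' x) q \<and>
        (AE x in lebesgue. - l\<^sup>2 * (\<rho> x * k\<^sup>2 * \<phi> x - q x) =
             l * \<mu> * (\<phi>4 x - 2 * k\<^sup>2 * \<phi>'' x + k ^ 4 * \<phi> x) - g * k\<^sup>2 * \<rho>' x * \<phi> x))"

lemma growing_mode_exists:
  assumes "\<epsilon> > 0"
  shows "\<exists>l \<phi>. 0 < l \<and> l < \<epsilon> \<and> growing_mode l \<phi>"
proof -
  \<comment> \<open>Halving turns the bound \<open>l \<le> \<epsilon> / 2\<close> into the strict
    one.\<close>
  have "\<epsilon> / 2 > 0" using assms by simp
  from interior_mode_exists[OF this]
  obtain l V Y G N where l: "0 < l" "l \<le> \<epsilon> / 2" and mode: "interior_mode l V Y G N"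
    by blast
  obtain \<Phi> :: "nat \<Rightarrow> real \<Rightarrow> real" where D: "\<And>i x. i < 4 \<Longrightarrow> (\<Phi> i has_real_derivative \<Phi> (Suc i) x) (at x)"
    and ode: "\<And>x. \<Phi> 4 x = 2 * k\<^sup>2 * \<Phi> 2 x - k ^ 4 * \<Phi> 0 x
        + l / \<mu> * (\<rho>' x * \<Phi> 1 x + \<rho> x * \<Phi> 2 x - \<rho> x * k\<^sup>2 * \<Phi> 0 x) + g * k\<^sup>2 / (l * \<mu>) * \<rho>' x * \<Phi> 0 x"
    and decay: "\<And>i. i \<le> 4 \<Longrightarrow> \<exists>A. \<forall>x. \<bar>x\<bar> > a \<longrightarrow> \<bar>\<Phi> i x\<bar> \<le> A * exp (- k * \<bar>x\<bar>)"
    and nz: "\<exists>x. \<Phi> 0 x \<noteq> 0"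
    using classical_mode_exists[OF mode l(1)] by blast
  have c3: "continuous_on UNIV (\<Phi> i)" if "i < 4" for i
    using DERIV_isCont[OF D[OF that]] by (simp add: continuous_at_imp_continuous_on)
  \<comment> \<open>Order 4 is continuous because the equation expresses it through lower orders and
    the continuous \<open>\<rho>'\<close>.\<close>
  have "continuous_on UNIV (\<Phi> 4)"
    unfolding ode[abs_def] by (intro continuous_intros rho'_cont rho_continuous c3) auto
  with c3 have c: "continuous_on UNIV (\<Phi> i)" if "i \<le> 4" for i
    using that by (cases "i = 4") auto
  have L2: "\<Phi> i \<in> L2" if i: "i \<le> 4" for i
  proof -
    obtain A where "\<forall>x. \<bar>x\<bar> > a \<longrightarrow> \<bar>\<Phi> i x\<bar> \<le> A * exp (- k * \<bar>x\<bar>)" using decay[OF i] by blast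
    then show ?thesis using L2_of_exponential_decay[OF c[OF i] k, of a A] by blast
  qed
  have w: "weak_deriv i (\<Phi> 0) (\<Phi> i)" if "i \<le> 4" for i
    by (rule weak_deriv_of_classical) (use that D c in auto)
  define q where "q = (\<lambda>x. \<rho>' x * \<Phi> 1 x + \<rho> x * \<Phi> 2 x)"
  have wq: "weak_deriv 1 (\<lambda>x. \<rho> x * \<Phi> 1 x) q"
  proof -
    let ?D = "\<lambda>i::nat. if i = 0 then (\<lambda>x. \<rho> x * \<Phi> 1 x) else q"
    have "weak_deriv 1 (?D 0) (?D 1)"
    proof (rule weak_deriv_of_classical)
      fix i :: nat and x assume "i < 1"
      moreover have "((\<lambda>x. \<rho> x * \<Phi> 1 x) has_real_derivative q x) (at x)"
        using DERIV_mult[OF rho_deriv D[of 1]] by (simp add: q_def numeral_2_eq_2 algebra_simps)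
      ultimately show "(?D i has_real_derivative ?D (Suc i) x) (at x)" by simp
    next
      show "continuous_on UNIV (?D 1)" unfolding q_def using c[of 1] c[of 2]
        by (auto intro!: continuous_intros rho'_cont rho_continuous)
    qed
    then show ?thesis by simp
  qed
  have "\<Phi> 0 \<in> sobolev_H 4" unfolding sobolev_H_def using L2 w by blast
  moreover have "\<not> (AE x in lebesgue. \<Phi> 0 x = 0)"
  proof
    assume "AE x in lebesgue. \<Phi> 0 x = 0"
    moreover have "continuous_on UNIV (\<Phi> 0)" by (rule c) simp
    ultimately have "\<Phi> 0 x = 0" for x using continuous_AE_zero by blast
    with nz show False by blast
  qed
  moreover have "- l\<^sup>2 * (\<rho> x * k\<^sup>2 * \<Phi> 0 x - q x) =
       l * \<mu> * (\<Phi> 4 x - 2 * k\<^sup>2 * \<Phi> 2 x + k ^ 4 * \<Phi> 0 x) - g * k\<^sup>2 * \<rho>' x * \<Phi> 0 x" for x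
    unfolding ode q_def using l \<mu> by (simp add: field_simps power2_eq_square)
  ultimately have "growing_mode l (\<Phi> 0)"
    unfolding growing_mode_def using w[of 1] w[of 2] w[of 4] wq
    by (intro conjI exI[of _ "\<Phi> 1"] exI[of _ "\<Phi> 2"] exI[of _ "\<Phi> 4"] exI[of _ q]) auto
  moreover have "l < \<epsilon>" using l assms by simp
  ultimately show ?thesis using l(1) by blast
qed

end

text \<open>Since modes exist below every positive threshold, dependent choice can pick each rate
  below its predecessor and below any prescribed bound.\<close>

theorem theorem2p1:
  fixes g \<mu> k a L\<^sub>0 \<rho>\<^sub>m \<rho>\<^sub>p :: real
    and \<rho>\<^sub>0 :: "real \<Rightarrow> real"
  assumes "g > 0" and "\<mu> > 0" and "k > 0" and "a > 0"
    and pos: "\<And>x. \<rho>\<^sub>0 x > 0"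
    and diff: "\<And>x. \<rho>\<^sub>0 differentiable (at x)"
    and cont: "continuous_on UNIV (deriv \<rho>\<^sub>0)"
    and nonneg: "\<And>x. deriv \<rho>\<^sub>0 x \<ge> 0"
    and supp: "closure {x. deriv \<rho>\<^sub>0 x \<noteq> 0} = {-a..a}"
    and left: "\<And>x. x \<le> -a \<Longrightarrow> \<rho>\<^sub>0 x = \<rho>\<^sub>m"
    and right: "\<And>x. x \<ge> a \<Longrightarrow> \<rho>\<^sub>0 x = \<rho>\<^sub>p"
    and "0 < \<rho>\<^sub>m" and "\<rho>\<^sub>m < \<rho>\<^sub>p"
    and "L\<^sub>0 > 0" and L0: "1 / L\<^sub>0 = (SUP x. deriv \<rho>\<^sub>0 x / \<rho>\<^sub>0 x)"
  shows "\<exists>(lam :: nat \<Rightarrow> real) (\<phi> :: nat \<Rightarrow> real \<Rightarrow> real).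
    (\<forall>n\<ge>1.
       0 < lam n \<and> lam n < sqrt (g / L\<^sub>0) \<and>
       \<phi> n \<in> sobolev_H 4 \<and>
       \<not> (AE x in lebesgue. \<phi> n x = 0) \<and>
       (\<exists>\<phi>' \<phi>'' \<phi>4 q.
          weak_deriv 1 (\<phi> n) \<phi>' \<and>
          weak_deriv 2 (\<phi> n) \<phi>'' \<and>
          weak_deriv 4 (\<phi> n) \<phi>4 \<and>
          weak_deriv 1 (\<lambda>x. \<rho>\<^sub>0 x * \<phi>' x) q \<and>
          (AE x in lebesgue.
             - (lam n)\<^sup>2 * (\<rho>\<^sub>0 x * k\<^sup>2 * \<phi> n x - q x) =
             lam n * \<mu> * (\<phi>4 x - 2 * k\<^sup>2 * \<phi>'' x + k ^ 4 * \<phi> n x)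
               - g * k\<^sup>2 * deriv \<rho>\<^sub>0 x * \<phi> n x))) \<and>
    (\<forall>n\<ge>1. lam (Suc n) < lam n) \<and>
    lam \<longlonglongrightarrow> 0"
proof -
  interpret rayleigh_taylor g \<mu> k a \<rho>\<^sub>0 "deriv \<rho>\<^sub>0" \<rho>\<^sub>m \<rho>\<^sub>p
    by unfold_locales (use assms in \<open>auto simp: DERIV_deriv_iff_real_differentiable\<close>)
  define s where "s = sqrt (g / L\<^sub>0)"
  have s: "s > 0" using assms by (simp add: s_def)
  \<comment> \<open>The bound \<open>1 / (n + 1)\<close> forces convergence to 0, and
    \<open>s\<close> is the upper limit demanded of the rates.\<close>
  let ?P = "\<lambda>(n::nat) l. 0 < l \<and> l < s \<and> l < 1 / (real n + 1) \<and> (\<exists>\<phi>. growing_mode l \<phi>)"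
  have "\<exists>f. \<forall>n. ?P n (f n) \<and> f (Suc n) < f n"
  proof (rule dependent_nat_choice)
    show "\<exists>l. ?P 0 l" using growing_mode_exists[of "min s 1"] s by auto
    show "\<exists>l'. ?P (Suc n) l' \<and> l' < l" if P: "?P n l" for l n
    proof -
      have "min l (1 / (real (Suc n) + 1)) > 0" using P by (simp add: add_pos_pos)
      from growing_mode_exists[OF this] obtain l' \<phi> where "0 < l'" "l' < min l (1 / (real (Suc n) + 1))" "growing_mode l' \<phi>"
        by blast
      with P show ?thesis by (intro exI[of _ l']) auto
    qed
  qed
  then obtain lam where lam: "\<And>n. ?P n (lam n)" "\<And>n. lam (Suc n) < lam n" by blast
  then have "\<forall>n. \<exists>\<phi>. growing_mode (lam n) \<phi>" by blast
  then obtain \<phi> where \<phi>: "\<And>n. growing_mode (lam n) (\<phi> n)" by metis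
  have lpos: "0 < lam n" "lam n < s" "lam n \<le> 1 / (real n + 1)" for n
    using lam(1)[of n] by (auto simp: less_imp_le)
  have "lam \<longlonglongrightarrow> 0"
  proof (rule tendsto_sandwich[OF _ _ tendsto_const])
    show "(\<lambda>n. 1 / (real n + 1)) \<longlonglongrightarrow> 0"
      using LIMSEQ_inverse_real_of_nat by (simp add: inverse_eq_divide add.commute)
    show "\<forall>\<^sub>F n in sequentially. 0 \<le> lam n" "\<forall>\<^sub>F n in sequentially. lam n \<le> 1 / (real n + 1)"
      using lpos by (auto simp: less_imp_le)
  qed
  with lpos lam(2) \<phi> show ?thesis
    by (intro exI[of _ lam] exI[of _ \<phi>]) (auto simp only: growing_mode_def s_def)
qed

end
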